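(* Let $X$ be a metrizable space. If the set of all non-isolated points of $X$ is compact, then the subspace $F_4(X)$ of the free topological group $F(X)$ is Fréchet-Urysohn.
   Context: For a Tychonoff space $X$, $F(X)$ denotes the (Markov) free topological group on $X$: as an abstract group it is the free group on the set $X$, it carries a group topology inducing the original topology on $X\subseteq F(X)$, and every continuous map from $X$ to an arbitrary topological group extends uniquely to a continuous homomorphism from $F(X)$. For $n\in\mathbb N=\{1,2,\ldots\}$, $F_n(X)$ is the subset of $F(X)$ consisting of all words of reduced length at most $n$ (with respect to the free basis $X$), equipped with the subspace topology from $F(X)$. A topological space $Y$ is Fréchet-Urysohn if for every $A\subseteq Y$ and every $y\in\overline{A}$ there is a sequence of points of $A$ converging to $y$. *)

theory Defs
  imports "HOL-Analysis.Analysis" "HOL-Algebra.Group"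
begin

section \<open>The free group on a set\<close>

text \<open>A letter \<open>(x, True)\<close> stands for the generator \<open>x\<close> and \<open>(x, False)\<close> for its formal
  inverse. The elements of the free group are the reduced words, so that the reduced length
  of an element is just its \<^const>\<open>length\<close>.\<close>

type_synonym 'a word = "('a \<times> bool) list"

definition inv_letter :: "'a \<times> bool \<Rightarrow> 'a \<times> bool" where
  "inv_letter a = (fst a, \<not> snd a)"

definition reduced_word :: "'a word \<Rightarrow> bool" where
  "reduced_word w \<longleftrightarrow> successively (\<lambda>a b. b \<noteq> inv_letter a) w"

fun cancel_cons :: "'a \<times> bool \<Rightarrow> 'a word \<Rightarrow> 'a word" where
  "cancel_cons a [] = [a]"
| "cancel_cons a (b # w) = (if b = inv_letter a then w else a # b # w)"

definition reduce :: "'a word \<Rightarrow> 'a word" where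
  "reduce w = foldr cancel_cons w []"

definition free_group :: "'a set \<Rightarrow> 'a word monoid" where
  "free_group S = \<lparr>carrier = {w. reduced_word w \<and> fst ` set w \<subseteq> S},
                   mult = (\<lambda>u v. reduce (u @ v)), one = []\<rparr>"

definition gen :: "'a \<Rightarrow> 'a word" where
  "gen x = [(x, True)]"

definition words_upto :: "'a set \<Rightarrow> nat \<Rightarrow> 'a word set" where
  "words_upto S n = {w \<in> carrier (free_group S). length w \<le> n}"


section \<open>Free topological groups\<close>

text \<open>Topological groups are not required to be Hausdorff.\<close>

definition topological_group :: "('g, 'm) monoid_scheme \<Rightarrow> 'g topology \<Rightarrow> bool" where
  "topological_group G T \<longleftrightarrow>
     group G \<and> topspace T = carrier G \<and>
     continuous_map (prod_topology T T) T (\<lambda>(x, y). x \<otimes>\<^bsub>G\<^esub> y) \<and>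
     continuous_map T T (\<lambda>x. inv\<^bsub>G\<^esub> x)"

text \<open>The members of \<open>extension_homs X T H TH f\<close> are the continuous homomorphisms from the free
  group with topology \<open>T\<close> to \<open>H\<close> extending \<open>f\<close>; \<^const>\<open>extensional\<close> normalises their values
  outside the carrier, so that uniqueness can be expressed by equality of functions.\<close>

definition extension_homs ::
    "'a topology \<Rightarrow> 'a word topology \<Rightarrow> ('h, 'm) monoid_scheme \<Rightarrow> 'h topology \<Rightarrow> ('a \<Rightarrow> 'h)
      \<Rightarrow> ('a word \<Rightarrow> 'h) set" where
  "extension_homs X T H TH f =
     {h \<in> extensional (carrier (free_group (topspace X))) \<inter> hom (free_group (topspace X)) H.
        continuous_map T TH h \<and> (\<forall>x\<in>topspace X. h (gen x) = f x)}"

text \<open>A definition cannot quantify over types, so the universal property is required only for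
  target groups \<open>H\<close> on the type \<^typ>\<open>'a word\<close>. This is no restriction: it implies the
  universal property for targets of every type
  (\<open>free_group_topology_universal\<close> below), determines the topology
  (\<open>free_group_topology_unique\<close>), and such a topology exists for every Tychonoff space
  (\<open>free_group_topology_exists\<close>).\<close>

definition free_group_topology :: "'a topology \<Rightarrow> 'a word topology \<Rightarrow> bool" where
  "free_group_topology X T \<longleftrightarrow>
     topological_group (free_group (topspace X)) T \<and>
     embedding_map X T gen \<and>
     (\<forall>(H :: 'a word monoid) TH f.
        topological_group H TH \<and> continuous_map X TH f \<longrightarrow>
        (\<exists>!h. h \<in> extension_homs X T H TH f))"


section \<open>Frechet-Urysohn spaces\<close>

definition Frechet_Urysohn_space :: "'a topology \<Rightarrow> bool" where
  "Frechet_Urysohn_space Y \<longleftrightarrow>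
     (\<forall>A y. A \<subseteq> topspace Y \<and> y \<in> Y closure_of A \<longrightarrow>
        (\<exists>s :: nat \<Rightarrow> 'a. range s \<subseteq> A \<and> limitin Y s y sequentially))"


section \<open>The free group is a group with the expected universal property\<close>

lemma inv_letter_inv_letter [simp]: "inv_letter (inv_letter a) = a"
  by (simp add: inv_letter_def)

lemma fst_inv_letter [simp]: "fst (inv_letter a) = fst a"
  by (simp add: inv_letter_def)

lemma reduced_Nil [simp]: "reduced_word []"
  and reduced_single [simp]: "reduced_word [a]"
  and reduced_Cons2: "reduced_word (a # b # w) \<longleftrightarrow> b \<noteq> inv_letter a \<and> reduced_word (b # w)"
  by (auto simp: reduced_word_def)

lemma reduced_tl: "reduced_word (a # w) \<Longrightarrow> reduced_word w"
  by (cases w) (auto simp: reduced_Cons2)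

lemma reduced_cancel_cons: "reduced_word w \<Longrightarrow> reduced_word (cancel_cons a w)"
  by (cases w) (auto simp: reduced_Cons2 dest: reduced_tl)

lemma reduced_foldr: "reduced_word w \<Longrightarrow> reduced_word (foldr cancel_cons u w)"
  by (induction u) (auto simp: reduced_cancel_cons)

lemma cancel_cons_reduced: "reduced_word (a # w) \<Longrightarrow> cancel_cons a w = a # w"
  by (cases w) (auto simp: reduced_Cons2)

lemma cancel_cons_inv: "reduced_word w \<Longrightarrow> cancel_cons a (cancel_cons (inv_letter a) w) = w"
  by (cases w) (auto simp: cancel_cons_reduced)

lemma reduced_reduce [simp]: "reduced_word (reduce w)"
  by (simp add: reduce_def reduced_foldr)

lemma reduce_reduced: "reduced_word w \<Longrightarrow> reduce w = w"
proof (induction w)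
  case (Cons a w)
  then have "foldr cancel_cons w [] = w"
    by (simp add: reduce_def reduced_tl)
  with Cons.prems show ?case
    by (simp add: reduce_def cancel_cons_reduced)
qed (simp add: reduce_def)

lemma foldr_cancel_cons:
  assumes "reduced_word w"
  shows "foldr cancel_cons (cancel_cons a v) w = cancel_cons a (foldr cancel_cons v w)"
  using assms by (cases v) (auto simp: cancel_cons_inv reduced_foldr)

lemma foldr_reduce: "reduced_word w \<Longrightarrow> foldr cancel_cons (reduce u) w = foldr cancel_cons u w"
  by (induction u) (auto simp: reduce_def foldr_cancel_cons)

lemma reduce_append: "reduce (u @ v) = foldr cancel_cons u (reduce v)"
  by (simp add: reduce_def)

lemma set_cancel_cons: "set (cancel_cons a w) \<subseteq> insert a (set w)"
  by (cases w) auto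

lemma set_reduce: "set (reduce w) \<subseteq> set w"
  unfolding reduce_def by (induction w) (use set_cancel_cons in fastforce)+

definition inv_word :: "'a word \<Rightarrow> 'a word" where
  "inv_word w = rev (map inv_letter w)"

lemma reduced_inv_word: "reduced_word w \<Longrightarrow> reduced_word (inv_word w)"
  unfolding reduced_word_def inv_word_def successively_rev successively_map
  by (erule successively_mono) (metis inv_letter_inv_letter)+

lemma fst_inv_word: "fst ` set (inv_word w) = fst ` set w"
  by (simp add: inv_word_def image_image)

lemma inv_word_left: "reduced_word w \<Longrightarrow> foldr cancel_cons (inv_word u @ u) w = w"
proof (induction u)
  case (Cons a u)
  have "cancel_cons (inv_letter a) (cancel_cons a v) = v" if "reduced_word v" for v
    using cancel_cons_inv[OF that, of "inv_letter a"] by simp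
  then show ?case
    using Cons by (simp add: inv_word_def reduced_foldr)
qed (simp add: inv_word_def)

lemma carrier_free_group: "carrier (free_group S) = {w. reduced_word w \<and> fst ` set w \<subseteq> S}"
  and mult_free_group [simp]: "u \<otimes>\<^bsub>free_group S\<^esub> v = reduce (u @ v)"
  and one_free_group [simp]: "\<one>\<^bsub>free_group S\<^esub> = []"
  by (simp_all add: free_group_def)

lemma reduce_closed:
  "u \<in> carrier (free_group S) \<Longrightarrow> v \<in> carrier (free_group S)
    \<Longrightarrow> reduce (u @ v) \<in> carrier (free_group S)"
  using set_reduce[of "u @ v"] by (fastforce simp: carrier_free_group)

lemma group_free_group: "group (free_group S)"
proof (rule groupI)
  fix u v w :: "'a word"
  show "u \<otimes>\<^bsub>free_group S\<^esub> v \<otimes>\<^bsub>free_group S\<^esub> w = u \<otimes>\<^bsub>free_group S\<^esub> (v \<otimes>\<^bsub>free_group S\<^esub> w)"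
    using reduce_append[of "reduce (u @ v)" w] reduce_append[of u "reduce (v @ w)"]
      reduce_append[of v w] foldr_reduce[of "reduce w" "u @ v"]
    by (simp add: reduce_reduced reduced_foldr)
next
  fix u v assume "u \<in> carrier (free_group S)" "v \<in> carrier (free_group S)"
  then show "u \<otimes>\<^bsub>free_group S\<^esub> v \<in> carrier (free_group S)"
    by (simp add: reduce_closed)
next
  fix u assume u: "u \<in> carrier (free_group S)"
  have "inv_word u \<in> carrier (free_group S)"
    using u by (simp add: carrier_free_group reduced_inv_word fst_inv_word)
  moreover have "inv_word u \<otimes>\<^bsub>free_group S\<^esub> u = \<one>\<^bsub>free_group S\<^esub>"
    using inv_word_left[of "[]" u] by (simp add: reduce_def)
  ultimately show "\<exists>y\<in>carrier (free_group S). y \<otimes>\<^bsub>free_group S\<^esub> u = \<one>\<^bsub>free_group S\<^esub>"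
    by blast
qed (auto simp: carrier_free_group reduce_reduced)

lemma gen_in_free_group [simp]: "gen x \<in> carrier (free_group S) \<longleftrightarrow> x \<in> S"
  by (simp add: gen_def carrier_free_group)

definition letter_val :: "('h, 'm) monoid_scheme \<Rightarrow> ('a \<Rightarrow> 'h) \<Rightarrow> 'a \<times> bool \<Rightarrow> 'h" where
  "letter_val H f a = (if snd a then f (fst a) else inv\<^bsub>H\<^esub> f (fst a))"

definition lift :: "('h, 'm) monoid_scheme \<Rightarrow> ('a \<Rightarrow> 'h) \<Rightarrow> 'a word \<Rightarrow> 'h" where
  "lift H f w = foldr (\<lambda>a y. letter_val H f a \<otimes>\<^bsub>H\<^esub> y) w \<one>\<^bsub>H\<^esub>"

lemma lift_simps [simp]:
  "lift H f [] = \<one>\<^bsub>H\<^esub>" "lift H f (a # w) = letter_val H f a \<otimes>\<^bsub>H\<^esub> lift H f w"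
  by (simp_all add: lift_def)

context
  fixes H :: "('h, 'm) monoid_scheme" and f :: "'a \<Rightarrow> 'h" and S :: "'a set"
  assumes H: "group H" and f: "f \<in> S \<rightarrow> carrier H"
begin

interpretation H: group H by (rule H)

lemma letter_val_closed: "fst a \<in> S \<Longrightarrow> letter_val H f a \<in> carrier H"
  using f by (auto simp: letter_val_def)

lemma letter_val_inv: "fst a \<in> S \<Longrightarrow> letter_val H f (inv_letter a) = inv\<^bsub>H\<^esub> letter_val H f a"
  using f by (auto simp: letter_val_def inv_letter_def Pi_iff)

lemma lift_closed: "fst ` set w \<subseteq> S \<Longrightarrow> lift H f w \<in> carrier H"
  by (induction w) (auto simp: letter_val_closed)

lemma lift_cancel_cons:
  assumes "fst a \<in> S" "fst ` set w \<subseteq> S"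
  shows "lift H f (cancel_cons a w) = letter_val H f a \<otimes>\<^bsub>H\<^esub> lift H f w"
proof (cases w)
  case (Cons b v)
  show ?thesis
  proof (cases "b = inv_letter a")
    case True
    then have "letter_val H f a \<otimes>\<^bsub>H\<^esub> (inv\<^bsub>H\<^esub> letter_val H f a \<otimes>\<^bsub>H\<^esub> lift H f v) = lift H f v"
      using assms Cons by (subst H.m_assoc[symmetric]) (auto simp: letter_val_closed lift_closed)
    then show ?thesis
      using assms Cons True by (simp add: letter_val_inv)
  qed (use Cons in auto)
qed simp

lemma lift_append:
  "fst ` set u \<subseteq> S \<Longrightarrow> fst ` set v \<subseteq> S \<Longrightarrow> lift H f (u @ v) = lift H f u \<otimes>\<^bsub>H\<^esub> lift H f v"
  by (induction u) (auto simp: lift_closed letter_val_closed H.m_assoc)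

lemma lift_reduce: "fst ` set w \<subseteq> S \<Longrightarrow> lift H f (reduce w) = lift H f w"
proof (induction w)
  case (Cons a w)
  have "fst ` set (reduce w) \<subseteq> S"
    using Cons.prems set_reduce[of w] by fastforce
  then have "lift H f (cancel_cons a (reduce w)) = letter_val H f a \<otimes>\<^bsub>H\<^esub> lift H f (reduce w)"
    using Cons.prems by (intro lift_cancel_cons) auto
  with Cons show ?case
    by (simp add: reduce_def)
qed (simp add: reduce_def)

lemma lift_hom: "lift H f \<in> hom (free_group S) H"
  by (rule homI) (auto simp: carrier_free_group lift_closed lift_reduce lift_append image_Un)

lemma lift_gen: "x \<in> S \<Longrightarrow> lift H f (gen x) = f x"
  using f by (auto simp: gen_def letter_val_def intro!: H.r_one)

lemma hom_eq_lift:
  assumes h: "h \<in> hom (free_group S) H" and hf: "\<And>x. x \<in> S \<Longrightarrow> h (gen x) = f x"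
    and w: "w \<in> carrier (free_group S)"
  shows "h w = lift H f w"
  using w
proof (induction w)
  case Nil
  interpret F: group "free_group S" by (rule group_free_group)
  interpret h: group_hom "free_group S" H h
    using h by unfold_locales
  show ?case
    using h.hom_one by simp
next
  case (Cons a w)
  interpret F: group "free_group S" by (rule group_free_group)
  interpret h: group_hom "free_group S" H h
    using h by unfold_locales
  have aS: "fst a \<in> S" and w: "w \<in> carrier (free_group S)" and red: "reduced_word (a # w)"
    using Cons.prems by (auto simp: carrier_free_group dest: reduced_tl)
  have single: "[b] \<in> carrier (free_group S)" if "fst b \<in> S" for b
    using that by (simp add: carrier_free_group)
  have "h [a] = letter_val H f a"
  proof (cases "snd a")
    case True
    then have "[a] = gen (fst a)"
      by (cases a) (simp add: gen_def)
    then show ?thesis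
      using True aS hf by (simp add: letter_val_def)
  next
    case False
    then have "[a] \<otimes>\<^bsub>free_group S\<^esub> gen (fst a) = \<one>\<^bsub>free_group S\<^esub>"
      by (cases a) (simp add: gen_def reduce_def inv_letter_def)
    then have "[a] = inv\<^bsub>free_group S\<^esub> gen (fst a)"
      using aS single by (intro F.inv_equality[symmetric]) auto
    then show ?thesis
      using False aS hf by (simp add: letter_val_def)
  qed
  moreover have "a # w = [a] \<otimes>\<^bsub>free_group S\<^esub> w"
    using red by (simp add: reduce_reduced)
  ultimately show ?case
    using Cons.IH[OF w] h.hom_mult[OF single[OF aS] w] by simp
qed

end


section \<open>Uniqueness, full universal property and existence of the topology\<close>

lemma topological_group_pullback:
  assumes "group G" "h \<in> hom G H" "topological_group H TH"
  shows "topological_group G (pullback_topology (carrier G) h TH)"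
proof -
  interpret G: group G by fact
  interpret H: group H using assms by (simp add: topological_group_def)
  interpret h: group_hom G H h using assms(2) by unfold_locales
  let ?P = "pullback_topology (carrier G) h TH"
  have TH: "topspace TH = carrier H"
    and mul: "continuous_map (prod_topology TH TH) TH (\<lambda>(x, y). x \<otimes>\<^bsub>H\<^esub> y)"
    and inv: "continuous_map TH TH (\<lambda>x. inv\<^bsub>H\<^esub> x)"
    using assms(3) by (auto simp: topological_group_def)
  have P: "topspace ?P = carrier G"
    by (auto simp: topspace_pullback_topology TH)
  have ch: "continuous_map ?P TH h"
    using continuous_map_pullback[OF continuous_map_id] by fastforce
  have "continuous_map (prod_topology ?P ?P) (prod_topology TH TH) (\<lambda>(x, y). (h x, h y))"
    using ch by (simp add: continuous_map_prod_top)
  from continuous_map_compose[OF this mul]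
  have "continuous_map (prod_topology ?P ?P) TH (h \<circ> (\<lambda>(x, y). x \<otimes>\<^bsub>G\<^esub> y))"
    by (rule continuous_map_eq) (auto simp: P)
  then have 1: "continuous_map (prod_topology ?P ?P) ?P (\<lambda>(x, y). x \<otimes>\<^bsub>G\<^esub> y)"
    by (rule continuous_map_pullback') (auto simp: P)
  have "continuous_map ?P TH (h \<circ> (\<lambda>x. inv\<^bsub>G\<^esub> x))"
    using continuous_map_compose[OF ch inv] by (rule continuous_map_eq) (auto simp: P)
  then have "continuous_map ?P ?P (\<lambda>x. inv\<^bsub>G\<^esub> x)"
    by (rule continuous_map_pullback') (auto simp: P)
  with 1 show ?thesis
    using P assms(1) by (simp add: topological_group_def)
qed

lemma universal_if_finest:
  fixes H :: "('h, 'm) monoid_scheme"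
  assumes T: "topspace T = carrier (free_group (topspace X))"
    and finest: "\<And>T'. topological_group (free_group (topspace X)) T' \<Longrightarrow> continuous_map X T' gen
                  \<Longrightarrow> continuous_map T T' id"
    and H: "topological_group H TH" and f: "continuous_map X TH f"
  shows "\<exists>!h. h \<in> extension_homs X T H TH f"
proof -
  let ?F = "free_group (topspace X)"
  let ?h = "lift H f"
  let ?P = "pullback_topology (carrier ?F) ?h TH"
  have gH: "group H" and TH: "topspace TH = carrier H"
    using H by (auto simp: topological_group_def)
  have fc: "f \<in> topspace X \<rightarrow> carrier H"
    using f TH by (auto simp: continuous_map_def)
  note hom = lift_hom[OF gH fc] and gen = lift_gen[OF gH fc]
  have "continuous_map X TH (?h \<circ> gen)"
    using f by (rule continuous_map_eq) (simp add: gen)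
  then have "continuous_map X ?P gen"
    by (rule continuous_map_pullback') auto
  then have "continuous_map T ?P id"
    using finest topological_group_pullback[OF group_free_group hom H] by blast
  moreover have "continuous_map ?P TH ?h"
    using continuous_map_pullback[OF continuous_map_id] by fastforce
  ultimately have "continuous_map T TH (?h \<circ> id)"
    by (rule continuous_map_compose)
  then have cont: "continuous_map T TH (restrict ?h (carrier ?F))"
    by (rule continuous_map_eq) (simp add: T)
  have "restrict ?h (carrier ?F) \<in> hom ?F H"
    using hom by (auto simp: hom_def reduce_closed)
  then have "restrict ?h (carrier ?F) \<in> extension_homs X T H TH f"
    using cont by (auto simp: extension_homs_def gen)
  moreover have "h = restrict ?h (carrier ?F)" if "h \<in> extension_homs X T H TH f" for h
    using that hom_eq_lift[OF gH fc, of h]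
    by (intro extensionalityI[of _ "carrier ?F"]) (auto simp: extension_homs_def)
  ultimately show ?thesis
    by blast
qed

lemma free_group_topology_finest:
  assumes "free_group_topology X T"
    and "topological_group (free_group (topspace X)) T'" "continuous_map X T' gen"
  shows "continuous_map T T' id"
proof -
  let ?F = "free_group (topspace X)"
  have T: "topspace T = carrier ?F"
    using assms(1) by (auto simp: free_group_topology_def topological_group_def)
  obtain h where h: "h \<in> extension_homs X T ?F T' gen"
    using assms unfolding free_group_topology_def by metis
  have g: "(gen :: 'a \<Rightarrow> _) \<in> topspace X \<rightarrow> carrier ?F"
    by auto
  have "id \<in> hom ?F ?F"
    by (simp add: hom_def)
  then have "h w = id w" if "w \<in> carrier ?F" for w
    using h that hom_eq_lift[OF group_free_group g, of h w]
      hom_eq_lift[OF group_free_group g, of id w]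
    by (auto simp: extension_homs_def)
  moreover have "continuous_map T T' h"
    using h by (simp add: extension_homs_def)
  ultimately show ?thesis
    using T by (metis continuous_map_eq)
qed

theorem free_group_topology_universal:
  fixes H :: "('h, 'm) monoid_scheme"
  assumes "free_group_topology X T" "topological_group H TH" "continuous_map X TH f"
  shows "\<exists>!h. h \<in> extension_homs X T H TH f"
  using assms(1) free_group_topology_finest[OF assms(1)] assms(2,3)
  by (intro universal_if_finest) (auto simp: free_group_topology_def topological_group_def)

theorem free_group_topology_unique:
  assumes "free_group_topology X T" "free_group_topology X T'"
  shows "T = T'"
proof -
  have *: "continuous_map T1 T2 id"
    if "free_group_topology X T1" "free_group_topology X T2" for T1 T2
    using that free_group_topology_finest[OF that(1)]
    by (metis embedding_map_def free_group_topology_def continuous_map_in_subtopology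
        homeomorphic_imp_continuous_map)
  have "topspace T = topspace T'"
    using assms by (simp add: free_group_topology_def topological_group_def)
  then show ?thesis
    using *[OF assms] *[OF assms(2,1)] topology_finer_continuous_id
    by (metis topology_eq)
qed

definition real_group :: "real monoid" where
  "real_group = \<lparr>carrier = UNIV, mult = (+), one = 0\<rparr>"

lemma group_real_group: "group real_group"
  by (rule groupI) (auto simp: real_group_def intro: exI[of _ "- _"])

lemma topological_group_real: "topological_group real_group euclideanreal"
proof -
  interpret R: group real_group by (rule group_real_group)
  have "inv\<^bsub>real_group\<^esub> x = - x" for x
    by (rule R.inv_equality) (auto simp: real_group_def)
  then show ?thesis
    using group_real_group
    by (auto simp: topological_group_def real_group_def case_prod_unfold intro!: continuous_intros)
qed

theorem free_group_topology_exists: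
  fixes X :: "'a topology"
  assumes X: "completely_regular_space X"
  shows "\<exists>T. free_group_topology X T"
proof -
  let ?F = "free_group (topspace X)"
  interpret F: group ?F by (rule group_free_group)
  define \<T> where "\<T> = {T'. topological_group ?F T' \<and> continuous_map X T' gen}"
  define \<S> where "\<S> = insert (carrier ?F) (\<Union>T'\<in>\<T>. {U. openin T' U})"
  define T where "T = topology_generated_by \<S>"
  have sub: "U \<subseteq> carrier ?F" if "U \<in> \<S>" for U
    using that openin_subset by (fastforce simp: \<S>_def \<T>_def topological_group_def)
  then have TF: "topspace T = carrier ?F"
    unfolding T_def topology_generated_by_topspace by (auto simp: \<S>_def)
  have finest: "continuous_map T T' id" if "T' \<in> \<T>" for T'
  proof -
    have "topspace T' = topspace T"
      using that TF by (simp add: \<T>_def topological_group_def)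
    moreover have "openin T U" if "openin T' U" for U
      unfolding T_def using that \<open>T' \<in> \<T>\<close> by (intro topology_generated_by_Basis) (auto simp: \<S>_def)
    ultimately show ?thesis
      using topology_finer_continuous_id by metis
  qed
  have into: "continuous_map Y T g"
    if "g \<in> topspace Y \<rightarrow> carrier ?F" "\<And>T'. T' \<in> \<T> \<Longrightarrow> continuous_map Y T' g"
    for Y :: "'b topology" and g
    unfolding T_def
  proof (rule continuous_on_generated_topo)
    fix U assume "U \<in> \<S>"
    moreover have "g -` carrier ?F \<inter> topspace Y = topspace Y"
      using that(1) by auto
    ultimately show "openin Y (g -` U \<inter> topspace Y)"
      using that(2) by (auto simp: \<S>_def continuous_map_alt)
  next
    show "g ` topspace Y \<subseteq> \<Union>\<S>"
      using that(1) by (auto simp: \<S>_def)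
  qed
  have mul: "continuous_map (prod_topology T T) T (\<lambda>(x, y). x \<otimes>\<^bsub>?F\<^esub> y)"
  proof (rule into)
    fix T' assume T': "T' \<in> \<T>"
    have "continuous_map (prod_topology T T) (prod_topology T' T') (\<lambda>(x, y). (id x, id y))"
      using finest[OF T'] continuous_map_prod_top by metis
    moreover have "continuous_map (prod_topology T' T') T' (\<lambda>(x, y). x \<otimes>\<^bsub>?F\<^esub> y)"
      using T' by (simp add: \<T>_def topological_group_def)
    ultimately have "continuous_map (prod_topology T T) T'
        ((\<lambda>(x, y). x \<otimes>\<^bsub>?F\<^esub> y) \<circ> (\<lambda>(x, y). (id x, id y)))"
      by (rule continuous_map_compose)
    then show "continuous_map (prod_topology T T) T' (\<lambda>(x, y). x \<otimes>\<^bsub>?F\<^esub> y)"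
      by (simp add: o_def case_prod_unfold)
  next
    show "(\<lambda>(x, y). x \<otimes>\<^bsub>?F\<^esub> y) \<in> topspace (prod_topology T T) \<rightarrow> carrier ?F"
      using F.m_closed by (auto simp: TF simp del: mult_free_group)
  qed
  have inv: "continuous_map T T (\<lambda>x. inv\<^bsub>?F\<^esub> x)"
  proof (rule into)
    fix T' assume T': "T' \<in> \<T>"
    then have "continuous_map T' T' (\<lambda>x. inv\<^bsub>?F\<^esub> x)"
      by (simp add: \<T>_def topological_group_def)
    from continuous_map_compose[OF finest[OF T'] this]
    show "continuous_map T T' (\<lambda>x. inv\<^bsub>?F\<^esub> x)"
      by (simp add: o_def)
  qed (simp add: TF)
  have rl: "\<exists>!h. h \<in> extension_homs X T real_group euclideanreal f"
    if "continuous_map X euclideanreal f" for f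
    using that finest TF topological_group_real
    by (intro universal_if_finest) (auto simp: \<T>_def)
  have un: "\<exists>!h. h \<in> extension_homs X T H TH f"
    if "topological_group H TH" "continuous_map X TH f"
    for H :: "'a word monoid" and TH f
    using that finest TF by (intro universal_if_finest) (auto simp: \<T>_def)
  have gen: "continuous_map X T gen"
    by (rule into) (auto simp: \<T>_def)
  have "open_map X (subtopology T (gen ` topspace X)) gen"
    unfolding open_map_def
  proof (intro allI impI)
    fix U assume U: "openin X U"
    have "\<exists>W. openin T W \<and> gen x \<in> W \<and> W \<inter> gen ` topspace X \<subseteq> gen ` U" if "x \<in> U" for x
    proof -
      have "closedin X (topspace X - U)" "x \<in> topspace X - (topspace X - U)"
        using U that openin_subset by auto
      then obtain f where f: "continuous_map X (top_of_set {0..1::real}) f" "f x = 0"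
          "f ` (topspace X - U) \<subseteq> {1}"
        using X unfolding completely_regular_space_def by blast
      then have "continuous_map X euclideanreal f"
        by (simp add: continuous_map_in_subtopology)
      then obtain h where "h \<in> extension_homs X T real_group euclideanreal f"
        using rl by blast
      then have h: "continuous_map T euclideanreal h" "\<And>y. y \<in> topspace X \<Longrightarrow> h (gen y) = f y"
        by (auto simp: extension_homs_def)
      have "openin T {w \<in> topspace T. h w \<in> {..<1}}"
        using h(1) by (rule openin_continuous_map_preimage) auto
      moreover have "x \<in> topspace X"
        using U that openin_subset by auto
      ultimately show ?thesis
        using h(2) f(2,3)
        by (intro exI[of _ "{w \<in> topspace T. h w \<in> {..<1}}"]) (force simp: TF)
    qed
    then obtain W where W: "\<And>x. x \<in> U \<Longrightarrow> openin T (W x) \<and> gen x \<in> W x \<and>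
        W x \<inter> gen ` topspace X \<subseteq> gen ` U"
      by metis
    have "gen ` U = (\<Union>x\<in>U. W x) \<inter> gen ` topspace X"
      using W openin_subset[OF U] by blast
    moreover have "openin T (\<Union>x\<in>U. W x)"
      using W by blast
    ultimately show "openin (subtopology T (gen ` topspace X)) (gen ` U)"
      by (auto simp: openin_subtopology)
  qed
  then have "embedding_map X (subtopology T (gen ` topspace X)) gen"
    using gen by (intro injective_open_imp_embedding_map)
      (auto simp: continuous_map_in_subtopology inj_on_def gen_def)
  then have "embedding_map X T gen"
    by (simp add: embedding_map_in_subtopology)
  then have "free_group_topology X T"
    using mul inv TF group_free_group un
    by (simp add: free_group_topology_def topological_group_def del: mult_free_group)
  then show ?thesis
    by blast
qed

corollary free_group_topology_exists_metrizable:
  "metrizable_space X \<Longrightarrow> \<exists>T. free_group_topology X T"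
  by (simp add: free_group_topology_exists metrizable_imp_completely_regular_space)

end

theory Submission
  imports Defs
begin

text \<open>Write \<open>K\<close> for the compact set of non-isolated points, and choose a metric \<open>\<rho>\<close> on \<open>X\<close>
  in which distinct \<open>\<rho>\<close>-close points are both close to \<open>K\<close>. As in Graev's construction, the words
  admitting a noncrossing matching of letters of opposite sign with small total \<open>\<rho>\<close>-cost form a
  neighbourhood base at the identity of a group topology on the free group which is coarser than
  the free one. Letting a matched pair \<open>x \<dots> y\<^sup>-\<^sup>1\<close> multiply the cost of what it encloses by a
  weight \<open>s x \<ge> 1\<close> keeps this true, provided that \<open>s\<close> is locally constant.

  Let \<open>w\<close> be in the closure of \<open>A \<subseteq> F\<^sub>4(X)\<close>, and take \<open>u \<in> A\<close> such that \<open>w\<^sup>-\<^sup>1 u\<close> has a cheap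
  matching. Matched neighbouring letters of the reduced word \<open>u\<close> are distinct, hence close to \<open>K\<close>.
  As \<open>u\<close> has at most four letters, every letter of \<open>u\<close> is close to \<open>K\<close> or to a letter of \<open>w\<close>,
  unless \<open>w\<close> is the identity and \<open>u = x y z\<^sup>-\<^sup>1 x\<^sup>-\<^sup>1\<close> up to signs. If all letters are controlled,
  compactness of \<open>K\<close> yields a subsequence along which they converge, and the limit word represents
  \<open>w\<close>. In the exceptional case either a single \<open>x\<close> occurs with \<open>\<rho> y z\<close> arbitrarily small, which
  is handled in the same way, or \<open>\<rho> y z\<close> is bounded below for every \<open>x\<close>; then taking the inverses
  of these bounds as weights gives a neighbourhood of the identity missing \<open>A\<close>.\<close>


section \<open>Group topologies from neighbourhoods of the identity\<close>

text \<open>The sets \<open>V \<epsilon>\<close> behave like the open balls about the identity of a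
  length function that may be infinite and need not be invariant under conjugation;
  \<open>V_conj\<close> makes up for the latter.\<close>

locale group_nbhd_base = group G for G (structure) +
  fixes V :: "real \<Rightarrow> 'a set"
  assumes V_closed: "V \<epsilon> \<subseteq> carrier G"
    and V_one: "\<epsilon> > 0 \<Longrightarrow> \<one> \<in> V \<epsilon>"
    and V_mono: "\<delta> \<le> \<epsilon> \<Longrightarrow> V \<delta> \<subseteq> V \<epsilon>"
    and V_mult: "u \<in> V \<delta> \<Longrightarrow> v \<in> V \<epsilon> \<Longrightarrow> u \<otimes> v \<in> V (\<delta> + \<epsilon>)"
    and V_inv: "u \<in> V \<epsilon> \<Longrightarrow> inv u \<in> V \<epsilon>"
    and V_rounded: "u \<in> V \<epsilon> \<Longrightarrow> \<exists>\<delta><\<epsilon>. u \<in> V \<delta>"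
    and V_conj: "g \<in> carrier G \<Longrightarrow> \<epsilon> > 0 \<Longrightarrow> \<exists>\<delta>>0. \<forall>v\<in>V \<delta>. g \<otimes> v \<otimes> inv g \<in> V \<epsilon>"
begin

definition V_topology :: "'a topology" where
  "V_topology = topology (\<lambda>U. U \<subseteq> carrier G \<and> (\<forall>g\<in>U. \<exists>\<epsilon>>0. \<forall>v\<in>V \<epsilon>. g \<otimes> v \<in> U))"

lemma openin_V_topology:
  "openin V_topology U \<longleftrightarrow> U \<subseteq> carrier G \<and> (\<forall>g\<in>U. \<exists>\<epsilon>>0. \<forall>v\<in>V \<epsilon>. g \<otimes> v \<in> U)"
proof -
  have "istopology (\<lambda>U. U \<subseteq> carrier G \<and> (\<forall>g\<in>U. \<exists>\<epsilon>>0. \<forall>v\<in>V \<epsilon>. g \<otimes> v \<in> U))"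
    unfolding istopology_def
  proof (rule conjI; intro allI impI conjI ballI)
    fix U W g
    assume U: "U \<subseteq> carrier G \<and> (\<forall>g\<in>U. \<exists>\<epsilon>>0. \<forall>v\<in>V \<epsilon>. g \<otimes> v \<in> U)"
      and W: "W \<subseteq> carrier G \<and> (\<forall>g\<in>W. \<exists>\<epsilon>>0. \<forall>v\<in>V \<epsilon>. g \<otimes> v \<in> W)"
    then show "U \<inter> W \<subseteq> carrier G" by blast
    assume "g \<in> U \<inter> W"
    then obtain \<delta> \<epsilon> where "\<delta> > 0" "\<forall>v\<in>V \<delta>. g \<otimes> v \<in> U" "\<epsilon> > 0" "\<forall>v\<in>V \<epsilon>. g \<otimes> v \<in> W"
      using U W by blast
    then show "\<exists>\<epsilon>>0. \<forall>v\<in>V \<epsilon>. g \<otimes> v \<in> U \<inter> W"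
      using V_mono[of "min \<delta> \<epsilon>" \<delta>] V_mono[of "min \<delta> \<epsilon>" \<epsilon>]
      by (intro exI[of _ "min \<delta> \<epsilon>"]) auto
  next
    fix \<U> assume *: "\<forall>U\<in>\<U>. U \<subseteq> carrier G \<and> (\<forall>g\<in>U. \<exists>\<epsilon>>0. \<forall>v\<in>V \<epsilon>. g \<otimes> v \<in> U)"
    then show "\<Union>\<U> \<subseteq> carrier G" by blast
    fix g assume "g \<in> \<Union>\<U>"
    then obtain U where "U \<in> \<U>" "g \<in> U" by blast
    then show "\<exists>\<epsilon>>0. \<forall>v\<in>V \<epsilon>. g \<otimes> v \<in> \<Union>\<U>"
      using * by (meson UnionI)
  qed
  then show ?thesis
    by (simp add: V_topology_def topology_inverse')
qed

lemma topspace_V_topology: "topspace V_topology = carrier G"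
proof -
  have "openin V_topology (carrier G)"
    unfolding openin_V_topology using V_closed by (meson m_closed subset_iff zero_less_one order_refl)
  then show ?thesis
    by (metis openin_V_topology openin_subset openin_topspace subset_antisym)
qed

text \<open>\<open>V_rounded\<close> puts \<open>h\<close> into the translate of some radius
  \<open>\<delta> < \<epsilon>\<close>, and \<open>V_mult\<close> then leaves room
  \<open>\<epsilon> - \<delta>\<close> around \<open>h\<close>.\<close>

lemma openin_V_translate:
  assumes g: "g \<in> carrier G"
  shows "openin V_topology {h \<in> carrier G. inv g \<otimes> h \<in> V \<epsilon>}"
  unfolding openin_V_topology
proof (intro conjI ballI)
  fix h assume "h \<in> {h \<in> carrier G. inv g \<otimes> h \<in> V \<epsilon>}"
  then obtain \<delta> where h: "h \<in> carrier G" and \<delta>: "\<delta> < \<epsilon>" "inv g \<otimes> h \<in> V \<delta>"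
    using V_rounded by blast
  have "h \<otimes> v \<in> carrier G \<and> inv g \<otimes> (h \<otimes> v) \<in> V \<epsilon>" if v: "v \<in> V (\<epsilon> - \<delta>)" for v
    using V_mult[OF \<delta>(2) v] V_closed v g h by (auto simp: m_assoc subset_iff)
  then show "\<exists>r>0. \<forall>v\<in>V r. h \<otimes> v \<in> {h \<in> carrier G. inv g \<otimes> h \<in> V \<epsilon>}"
    using \<delta>(1) by (intro exI[of _ "\<epsilon> - \<delta>"]) auto
qed auto

lemma V_topology_nbhd:
  assumes "openin V_topology U" "g \<in> U"
  obtains \<epsilon> where "\<epsilon> > 0" "{h \<in> carrier G. inv g \<otimes> h \<in> V \<epsilon>} \<subseteq> U"
proof -
  from assms obtain \<epsilon> where \<epsilon>: "\<epsilon> > 0" "\<forall>v\<in>V \<epsilon>. g \<otimes> v \<in> U" and g: "g \<in> carrier G"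
    unfolding openin_V_topology by blast
  have "h \<in> U" if "h \<in> carrier G" "inv g \<otimes> h \<in> V \<epsilon>" for h
    using \<epsilon>(2) that g by (metis inv_solve_left' m_closed inv_closed)
  then show ?thesis
    using \<epsilon>(1) that by blast
qed

lemma V_self: "g \<in> carrier G \<Longrightarrow> \<epsilon> > 0 \<Longrightarrow> inv g \<otimes> g \<in> V \<epsilon>"
  by (simp add: V_one)

lemma V_conj': "g \<in> carrier G \<Longrightarrow> \<epsilon> > 0 \<Longrightarrow> \<exists>\<delta>>0. \<forall>v\<in>V \<delta>. inv g \<otimes> v \<otimes> g \<in> V \<epsilon>"
  using V_conj[of "inv g"] by simp

lemma topological_group_V: "topological_group G V_topology"
  unfolding topological_group_def
proof (intro conjI)
  show "continuous_map (prod_topology V_topology V_topology) V_topology (\<lambda>(x, y). x \<otimes> y)"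
    unfolding continuous_map_def
  proof (intro conjI allI impI)
    fix U assume U: "openin V_topology U"
    show "openin (prod_topology V_topology V_topology)
        {p \<in> topspace (prod_topology V_topology V_topology). (case p of (x, y) \<Rightarrow> x \<otimes> y) \<in> U}"
      unfolding openin_prod_topology_alt
    proof (intro allI impI)
      fix g h
      assume "(g, h) \<in> {p \<in> topspace (prod_topology V_topology V_topology).
                (case p of (x, y) \<Rightarrow> x \<otimes> y) \<in> U}"
      then have gh: "g \<in> carrier G" "h \<in> carrier G" "g \<otimes> h \<in> U"
        by (auto simp: topspace_V_topology)
      obtain \<epsilon> where \<epsilon>: "\<epsilon> > 0" "{k \<in> carrier G. inv (g \<otimes> h) \<otimes> k \<in> V \<epsilon>} \<subseteq> U"
        using V_topology_nbhd[OF U gh(3)] by blast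
      \<comment> \<open>The quotient of \<open>a \<otimes> b\<close> by \<open>g \<otimes> h\<close>
        is \<open>inv h \<otimes> (inv g \<otimes> a) \<otimes> h\<close> times
        \<open>inv h \<otimes> b\<close>, so \<open>inv g \<otimes> a\<close> has to stay small
        after conjugation by \<open>h\<close>.\<close>
      obtain \<delta> where \<delta>: "\<delta> > 0" "\<forall>v\<in>V \<delta>. inv h \<otimes> v \<otimes> h \<in> V (\<epsilon>/2)"
        using V_conj'[OF gh(2), of "\<epsilon>/2"] \<epsilon>(1) by auto
      let ?A = "{k \<in> carrier G. inv g \<otimes> k \<in> V \<delta>}"
      let ?B = "{k \<in> carrier G. inv h \<otimes> k \<in> V (\<epsilon>/2)}"
      have "a \<otimes> b \<in> U" if a: "a \<in> ?A" and b: "b \<in> ?B" for a b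
      proof -
        have ab: "a \<in> carrier G" "b \<in> carrier G"
          using a b by auto
        have "(inv h \<otimes> (inv g \<otimes> a) \<otimes> h) \<otimes> (inv h \<otimes> b) \<in> V (\<epsilon>/2 + \<epsilon>/2)"
          using a b \<delta>(2) by (intro V_mult) auto
        moreover have "h \<otimes> (inv h \<otimes> b) = b"
          using ab gh by (simp flip: m_assoc)
        then have "(inv h \<otimes> (inv g \<otimes> a) \<otimes> h) \<otimes> (inv h \<otimes> b) = inv (g \<otimes> h) \<otimes> (a \<otimes> b)"
          using ab gh by (simp add: m_assoc inv_mult_group)
        ultimately show ?thesis
          using \<epsilon>(2) ab by auto
      qed
      then show "\<exists>A B. openin V_topology A \<and> openin V_topology B \<and> g \<in> A \<and> h \<in> B \<and>
          A \<times> B \<subseteq> {p \<in> topspace (prod_topology V_topology V_topology).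
                     (case p of (x, y) \<Rightarrow> x \<otimes> y) \<in> U}"
        using gh \<epsilon>(1) \<delta>(1) V_self
        by (intro exI[of _ ?A] exI[of _ ?B])
          (auto simp: openin_V_translate topspace_V_topology)
    qed
  qed (auto simp: topspace_V_topology)
  show "continuous_map V_topology V_topology (\<lambda>x. inv x)"
    unfolding continuous_map_def
  proof (intro conjI allI impI)
    fix U assume U: "openin V_topology U"
    show "openin V_topology {x \<in> topspace V_topology. inv x \<in> U}"
      unfolding openin_V_topology
    proof (intro conjI ballI)
      fix g assume g: "g \<in> {x \<in> topspace V_topology. inv x \<in> U}"
      then have gG: "g \<in> carrier G"
        by (simp add: topspace_V_topology)
      obtain \<epsilon> where \<epsilon>: "\<epsilon> > 0" "{k \<in> carrier G. inv (inv g) \<otimes> k \<in> V \<epsilon>} \<subseteq> U"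
        using V_topology_nbhd[OF U] g by blast
      \<comment> \<open>Inversion turns the displacement \<open>v\<close> into a conjugate: \<open>g
        \<otimes> inv (g \<otimes> v) = g \<otimes> inv v \<otimes> inv g\<close>.\<close>
      obtain \<delta> where \<delta>: "\<delta> > 0" "\<forall>v\<in>V \<delta>. g \<otimes> v \<otimes> inv g \<in> V \<epsilon>"
        using V_conj[OF gG \<epsilon>(1)] by blast
      have "inv (g \<otimes> v) \<in> U" if v: "v \<in> V \<delta>" for v
      proof -
        have "v \<in> carrier G"
          using v V_closed by blast
        moreover have "g \<otimes> inv v \<otimes> inv g \<in> V \<epsilon>"
          using \<delta>(2) V_inv[OF v] by blast
        ultimately show ?thesis
          using \<epsilon>(2) gG by (auto simp: inv_mult_group m_assoc)
      qed
      then show "\<exists>\<delta>>0. \<forall>v\<in>V \<delta>. g \<otimes> v \<in> {x \<in> topspace V_topology. inv x \<in> U}"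
        using \<delta>(1) gG V_closed by (intro exI[of _ \<delta>]) (auto simp: topspace_V_topology)
    qed (auto simp: topspace_V_topology)
  qed (auto simp: topspace_V_topology)
qed (auto simp: topspace_V_topology)

end

section \<open>Weighted noncrossing matchings\<close>

text \<open>The last argument is an upper bound for the cost of some matching, not its exact cost.\<close>

inductive matched :: "'a set \<Rightarrow> ('a \<Rightarrow> 'a \<Rightarrow> real) \<Rightarrow> ('a \<Rightarrow> real) \<Rightarrow> 'a word \<Rightarrow> real \<Rightarrow> bool"
  for S \<rho> s where
  Nil: "0 \<le> c \<Longrightarrow> matched S \<rho> s [] c"
| Pair: "matched S \<rho> s u a \<Longrightarrow> matched S \<rho> s v b \<Longrightarrow> x \<in> S \<Longrightarrow> y \<in> S \<Longrightarrow> s x = s y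
    \<Longrightarrow> \<rho> x y + s x * a + b \<le> c \<Longrightarrow> matched S \<rho> s ((x, e) # u @ (y, \<not> e) # v) c"

text \<open>The bound \<open>1 \<le> s x\<close> ensures that no part of a matching becomes more
  expensive when a pair enclosing it disappears.\<close>

locale weighted_metric = Metric_space S \<rho> for S :: "'a set" and \<rho> +
  fixes s :: "'a \<Rightarrow> real"
  assumes weight_ge_1: "1 \<le> s x"
begin

lemma le_weight_mult: "0 \<le> a \<Longrightarrow> a \<le> s x * a"
  using mult_right_mono[OF weight_ge_1] by fastforce

lemma matched_nonneg: "matched S \<rho> s w c \<Longrightarrow> 0 \<le> c"
proof (induction rule: matched.induct)
  case (Pair u a v b x y c e)
  then show ?case
    using nonneg[of x y] le_weight_mult[of a x] by linarith
qed

lemma matched_mono: "matched S \<rho> s w c \<Longrightarrow> c \<le> c' \<Longrightarrow> matched S \<rho> s w c'"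
  by (erule matched.cases) (auto intro: matched.intros)

lemma matched_carrier: "matched S \<rho> s w c \<Longrightarrow> fst ` set w \<subseteq> S"
  by (induction rule: matched.induct) auto

lemma even_length_matched: "matched S \<rho> s w c \<Longrightarrow> even (length w)"
  by (induction rule: matched.induct) auto

lemma matched_append:
  "matched S \<rho> s u a \<Longrightarrow> matched S \<rho> s v b \<Longrightarrow> a + b \<le> c \<Longrightarrow> matched S \<rho> s (u @ v) c"
proof (induction arbitrary: c rule: matched.induct)
  case (Nil a)
  then show ?case
    by (auto intro: matched_mono)
next
  case (Pair u a' v' b' x y a e)
  then have "matched S \<rho> s (v' @ v) (b' + b)"
    by simp
  with Pair have "matched S \<rho> s ((x, e) # u @ (y, \<not> e) # (v' @ v)) c"
    by (intro matched.Pair[of _ _ _ u a' "v' @ v" "b' + b"]) auto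
  then show ?case
    by simp
qed

lemma matched_wrap:
  assumes "matched S \<rho> s u a" "x \<in> S" "y \<in> S" "s x = s y" "\<rho> x y + s x * a \<le> c"
  shows "matched S \<rho> s ((x, e) # u @ [(y, \<not> e)]) c"
  using matched.Pair[OF assms(1) matched.Nil[of 0] assms(2-4)] assms(5) by simp

lemma matched_first:
  assumes "matched S \<rho> s ((x, e) # w) c"
  obtains u y v a b where "w = u @ (y, \<not> e) # v" "matched S \<rho> s u a" "matched S \<rho> s v b"
    "x \<in> S" "y \<in> S" "s x = s y" "\<rho> x y + s x * a + b \<le> c"
  using assms by (cases rule: matched.cases) auto

text \<open>Mirror image of \<open>matched_first\<close>. The inductive definition exposes only the
  partner of the first letter, so the last letter has to be reached by induction.\<close>

lemma matched_last:
  assumes "matched S \<rho> s (w @ [(y, \<not> e)]) c"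
  shows "\<exists>u x v a b. w = u @ (x, e) # v \<and> matched S \<rho> s u a \<and> matched S \<rho> s v b \<and>
    x \<in> S \<and> y \<in> S \<and> s x = s y \<and> a + \<rho> x y + s x * b \<le> c"
  using assms
proof (induction "w @ [(y, \<not> e)]" c arbitrary: w rule: matched.induct)
  case (Pair u a v b x y' c e')
  show ?case
  proof (cases v rule: rev_cases)
    case Nil
    then have "w = [] @ (x, e) # u" "y' = y" "e' = e"
      using Pair.hyps(9) by auto
    then show ?thesis
      using Pair.hyps matched.Nil[of 0 S \<rho> s] matched_nonneg[OF Pair.hyps(3)]
      by (intro exI[of _ "[]"] exI[of _ x] exI[of _ u] exI[of _ 0] exI[of _ a]) auto
  next
    case (snoc v' z)
    with Pair.hyps(9) have w: "w = (x, e') # u @ (y', \<not> e') # v'" and v: "v = v' @ [(y, \<not> e)]"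
      by auto
    obtain v1 z v2 a' b' where z: "v' = v1 @ (z, e) # v2" "matched S \<rho> s v1 a'"
      "matched S \<rho> s v2 b'" "z \<in> S" "y \<in> S" "s z = s y" "a' + \<rho> z y + s z * b' \<le> b"
      using Pair.hyps(4)[OF v] by blast
    have "matched S \<rho> s ((x, e') # u @ (y', \<not> e') # v1) (\<rho> x y' + s x * a + a')"
      using Pair.hyps z by (intro matched.Pair) auto
    moreover have "w = ((x, e') # u @ (y', \<not> e') # v1) @ (z, e) # v2"
      using w z(1) by simp
    ultimately show ?thesis
      using z Pair.hyps(8) by (smt (verit))
  qed
qed auto

text \<open>If the two letters of a cancelling pair have other partners, match those two
  partners with each other. Since weights are at least 1, the cost does not increase.\<close>

lemma matched_cancel:
  assumes "matched S \<rho> s (p @ z # inv_letter z # q) c"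
  shows "matched S \<rho> s (p @ q) c"
  using assms
proof (induction "p @ z # inv_letter z # q" c arbitrary: p z q rule: matched.induct)
  case (Pair u a v b x y c e)
  note P = Pair.hyps
  have a0: "0 \<le> a" and b0: "0 \<le> b"
    using P matched_nonneg by auto
  \<comment> \<open>Here the cancelling pair starts with the opening letter \<open>x\<close>. If
    \<open>u\<close> is not empty, it starts with the inverse of \<open>x\<close>, whose partner is
    then matched with \<open>y\<close>; the triangle inequality through \<open>x\<close> pays for
    this.\<close>
  have rest: ?case if "p = []"
  proof (cases u)
    case Nil
    then have "q = v" using that P(9) by auto
    moreover have "b \<le> c"
      using P(8) a0 le_weight_mult[of a x] nonneg[of x y] by linarith
    ultimately show ?thesis
      using that by (auto intro: matched_mono[OF P(3)])
  next
    case (Cons b' u')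
    then have u: "u = (x, \<not> e) # u'" and q: "q = u' @ (y, \<not> e) # v"
      using that P(9) by (auto simp: inv_letter_def)
    from P(1) u obtain u1 z u2 a1 a2 where *: "u' = u1 @ (z, e) # u2" "matched S \<rho> s u1 a1"
      "matched S \<rho> s u2 a2" "z \<in> S" "s x = s z" "\<rho> x z + s x * a1 + a2 \<le> a"
      by (auto elim!: matched_first)
    have "\<rho> z y \<le> \<rho> x z + \<rho> x y"
      using triangle[of z x y] * P commute[of x z] by simp
    moreover have "s x * (\<rho> x z + s x * a1 + a2) \<le> s x * a"
      using *(6) weight_ge_1[of x] by (intro mult_left_mono) auto
    then have "s x * \<rho> x z + s x * (s x * a1) + s x * a2 \<le> s x * a"
      by (simp add: algebra_simps)
    moreover have "\<rho> x z \<le> s x * \<rho> x z" "a1 \<le> s x * a1" "s x * a1 \<le> s x * (s x * a1)"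
      using matched_nonneg[OF *(2)] weight_ge_1[of x] by (auto intro!: le_weight_mult)
    ultimately have "a1 + (\<rho> z y + s z * a2 + b) \<le> c"
      using P(8) *(5) by simp
    moreover have "matched S \<rho> s ((z, e) # u2 @ (y, \<not> e) # v) (\<rho> z y + s z * a2 + b)"
      using * P by (intro matched.Pair) auto
    ultimately show ?thesis
      using that q *(1,2) matched_append by force
  qed
  show ?case
  proof (cases p)
    case Nil
    then show ?thesis by (rule rest)
  next
    case (Cons p0 p')
    then have p: "p = (x, e) # p'" and eq: "u @ (y, \<not> e) # v = p' @ z # inv_letter z # q"
      using P(9) by auto
    \<comment> \<open>Position of the cancelling pair relative to the closing letter
      \<open>(y, \<not> e)\<close>: inside \<open>u\<close>, ending at this letter, starting at it,
      or inside \<open>v\<close>.\<close>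
    consider (l) us where "u = p' @ z # inv_letter z # us" "q = us @ (y, \<not> e) # v"
      | (m) "u = p' @ [z]" "inv_letter z = (y, \<not> e)" "q = v"
      | (n) "u = p'" "z = (y, \<not> e)" "v = inv_letter z # q"
      | (r) us where "p' = u @ (y, \<not> e) # us" "v = us @ z # inv_letter z # q"
    proof -
      from eq obtain us where us: "u = p' @ us \<and> us @ (y, \<not> e) # v = z # inv_letter z # q \<or>
          u @ us = p' \<and> (y, \<not> e) # v = us @ z # inv_letter z # q"
        unfolding append_eq_append_conv2 by blast
      show thesis
      proof (cases us)
        case Nil
        then show thesis
          using us n by auto
      next
        case (Cons a us')
        then show thesis
          using us l m r by (cases us') auto
      qed
    qed
    then show ?thesis
    proof cases
      case l
      then have "matched S \<rho> s ((x, e) # (p' @ us) @ (y, \<not> e) # v) c"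
        using P by (intro matched.Pair) auto
      then show ?thesis
        using l p by simp
    next
      case m
      then have z: "z = (y, e)"
        by (cases z) (auto simp: inv_letter_def)
      \<comment> \<open>\<open>w\<close> is the partner of \<open>z\<close> inside \<open>u\<close>.
        It takes over from \<open>y\<close> as the partner of \<open>x\<close>, and
        \<open>u2\<close> leaves the enclosure.\<close>
      with m P(1) obtain u1 w u2 a1 a2 where *: "p' = u1 @ (w, \<not> e) # u2" "matched S \<rho> s u1 a1"
        "matched S \<rho> s u2 a2" "w \<in> S" "s w = s y" "a1 + \<rho> w y + s w * a2 \<le> a"
        using matched_last[of p' y "\<not> e" a] by auto
      have "\<rho> x w \<le> \<rho> x y + \<rho> w y"
        using triangle[of x y w] * P commute[of y w] by simp
      moreover have "s x * (a1 + \<rho> w y + s w * a2) \<le> s x * a"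
        using *(6) weight_ge_1[of x] by (intro mult_left_mono) auto
      then have "s x * a1 + s x * \<rho> w y + s x * (s x * a2) \<le> s x * a"
        using *(5) P(7) by (simp add: algebra_simps)
      moreover have "\<rho> w y \<le> s x * \<rho> w y" "a2 \<le> s x * a2" "s x * a2 \<le> s x * (s x * a2)"
        using matched_nonneg[OF *(3)] weight_ge_1[of x] by (auto intro!: le_weight_mult)
      ultimately have "\<rho> x w + s x * a1 + (a2 + b) \<le> c"
        using P(8) by simp
      moreover have "matched S \<rho> s (u2 @ v) (a2 + b)"
        using * P by (auto intro: matched_append)
      ultimately have "matched S \<rho> s ((x, e) # u1 @ (w, \<not> e) # (u2 @ v)) c"
        using * P by (intro matched.Pair[of _ _ _ u1 a1 "u2 @ v" "a2 + b"]) auto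
      then show ?thesis
        using p m *(1) by simp
    next
      case n
      then have v: "v = (y, e) # q"
        by (auto simp: inv_letter_def)
      \<comment> \<open>\<open>w\<close> becomes the partner of \<open>x\<close>, which now also
        encloses \<open>v1\<close>. The factor of \<open>v1\<close> stays the same because paired
        letters have equal weights.\<close>
      with P(3) obtain v1 w v2 b1 b2 where *: "q = v1 @ (w, \<not> e) # v2" "matched S \<rho> s v1 b1"
        "matched S \<rho> s v2 b2" "w \<in> S" "s y = s w" "\<rho> y w + s y * b1 + b2 \<le> b"
        by (auto elim!: matched_first)
      have "\<rho> x w \<le> \<rho> x y + \<rho> y w"
        using triangle[of x y w] * P by simp
      then have "\<rho> x w + s x * (a + b1) + b2 \<le> c"
        using P(7,8) *(6) by (simp add: algebra_simps)
      moreover have "matched S \<rho> s (u @ v1) (a + b1)"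
        using * P by (auto intro: matched_append)
      ultimately have "matched S \<rho> s ((x, e) # (u @ v1) @ (w, \<not> e) # v2) c"
        using * P by (intro matched.Pair[of _ _ _ "u @ v1" "a + b1" v2 b2]) auto
      then show ?thesis
        using p n *(1) by simp
    next
      case r
      then have "matched S \<rho> s ((x, e) # u @ (y, \<not> e) # (us @ q)) c"
        using P by (intro matched.Pair) auto
      then show ?thesis
        using r p by simp
    qed
  qed
qed auto

text \<open>Reduction is a sequence of cancellations as in \<open>matched_cancel\<close>. The
  context \<open>p\<close> is generalised because the induction moves letters of \<open>w\<close>
  into it.\<close>

lemma matched_reduce: "matched S \<rho> s (p @ w @ q) c \<Longrightarrow> matched S \<rho> s (p @ reduce w @ q) c"
proof (induction w arbitrary: p)
  case (Cons z w)
  then have *: "matched S \<rho> s (p @ z # reduce w @ q) c"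
    using Cons.IH[of "p @ [z]"] by simp
  have "matched S \<rho> s (p @ cancel_cons z v @ q) c" if "matched S \<rho> s (p @ z # v @ q) c" for v
  proof (cases v)
    case (Cons b v')
    show ?thesis
    proof (cases "b = inv_letter z")
      case True
      then have "matched S \<rho> s (p @ z # inv_letter z # (v' @ q)) c"
        using that Cons by simp
      then show ?thesis
        using True Cons by (auto dest: matched_cancel)
    next
      case False
      then show ?thesis
        using that Cons by simp
    qed
  qed (use that in simp)
  with * show ?case
    by (simp add: reduce_def)
qed (simp add: reduce_def)

lemma matched_reduce': "matched S \<rho> s w c \<Longrightarrow> matched S \<rho> s (reduce w) c"
  using matched_reduce[of "[]" w "[]"] by simp

lemma matched_inv_word: "matched S \<rho> s w c \<Longrightarrow> matched S \<rho> s (inv_word w) c"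
proof (induction rule: matched.induct)
  case (Pair u a v b x y c e)
  have "matched S \<rho> s ((y, e) # inv_word u @ [(x, \<not> e)]) (\<rho> x y + s x * a)"
    using Pair by (intro matched_wrap[of "inv_word u" a]) (auto simp: commute)
  then have "matched S \<rho> s (inv_word v @ (y, e) # inv_word u @ [(x, \<not> e)]) c"
    using Pair by (intro matched_append[of "inv_word v" b]) auto
  then show ?case
    by (simp add: inv_word_def inv_letter_def)
qed (simp add: inv_word_def matched.Nil)

text \<open>Each letter of \<open>g\<close> is paired with its own inverse at distance 0, which only
  multiplies the cost by its weight; \<open>C\<close> is the product of these weights.\<close>

lemma matched_conj:
  assumes "fst ` set g \<subseteq> S"
  obtains C where "C > 0" "\<And>v c. matched S \<rho> s v c \<Longrightarrow> matched S \<rho> s (g @ v @ inv_word g) (C * c)"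
proof -
  have "\<exists>C>0. \<forall>v c. matched S \<rho> s v c \<longrightarrow> matched S \<rho> s (g @ v @ inv_word g) (C * c)"
    using assms
  proof (induction g)
    case Nil
    then show ?case
      by (intro exI[of _ 1]) (simp add: inv_word_def)
  next
    case (Cons z g)
    then obtain C where C: "C > 0"
      "\<And>v c. matched S \<rho> s v c \<Longrightarrow> matched S \<rho> s (g @ v @ inv_word g) (C * c)"
      by auto
    obtain x e where z: "z = (x, e)" by fastforce
    have "matched S \<rho> s ((x, e) # (g @ v @ inv_word g) @ [(x, \<not> e)]) (s x * C * c)"
      if "matched S \<rho> s v c" for v c
      using Cons.prems z C(2)[OF that] by (intro matched_wrap) auto
    moreover have "s x * C > 0"
      using C(1) weight_ge_1[of x] by (simp add: zero_less_mult_iff)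
    ultimately show ?case
      using z by (intro exI[of _ "s x * C"]) (auto simp: inv_word_def inv_letter_def)
  qed
  then show ?thesis
    using that by blast
qed

end

section \<open>Partners of letters, and matchings that are too cheap to be nontrivial\<close>

context weighted_metric begin

text \<open>Extends \<open>matched_first\<close> to a letter in any position. The word between the
  letter and its partner, and the word left after deleting this whole block, still cost at most
  \<open>c\<close>, as weights are at least 1.\<close>

lemma matched_partner:
  assumes "matched S \<rho> s (p @ (x, e) # q) c"
  shows "(\<exists>p' y u. p = p' @ (y, \<not> e) # u \<and> y \<in> S \<and> \<rho> x y \<le> c \<and>
            matched S \<rho> s u c \<and> matched S \<rho> s (p' @ q) c) \<or>
         (\<exists>u y q'. q = u @ (y, \<not> e) # q' \<and> y \<in> S \<and> \<rho> x y \<le> c \<and>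
            matched S \<rho> s u c \<and> matched S \<rho> s (p @ q') c)"
    (is "?L p q c \<or> ?R p q c")
  using assms
proof (induction "p @ (x, e) # q" c arbitrary: p q rule: matched.induct)
  case (Pair u a v b x0 y0 c e0)
  note P = Pair.hyps
  have ab: "0 \<le> a" "0 \<le> b" "a \<le> s x0 * a" "0 \<le> \<rho> x0 y0"
    using P matched_nonneg le_weight_mult by auto
  then have le: "a \<le> c" "b \<le> c" "\<rho> x0 y0 \<le> c"
    using P(8) by linarith+
  consider (first) "p = []" "x = x0" "e = e0" "q = u @ (y0, \<not> e0) # v"
    | (l) p1 q1 where "p = (x0, e0) # p1" "u = p1 @ (x, e) # q1" "q = q1 @ (y0, \<not> e0) # v"
    | (second) "p = (x0, e0) # u" "x = y0" "e = (\<not> e0)" "q = v"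
    | (r) p1 where "p = (x0, e0) # u @ (y0, \<not> e0) # p1" "v = p1 @ (x, e) # q"
  proof (cases p)
    case Nil
    then show thesis
      using P(9) by (intro first) auto
  next
    case (Cons p0 p1)
    then have p: "p = (x0, e0) # p1" and "u @ (y0, \<not> e0) # v = p1 @ (x, e) # q"
      using P(9) by auto
    then obtain us where us: "u = p1 @ us \<and> us @ (y0, \<not> e0) # v = (x, e) # q \<or>
        u @ us = p1 \<and> (y0, \<not> e0) # v = us @ (x, e) # q"
      unfolding append_eq_append_conv2 by blast
    show thesis
    proof (cases us)
      case Nil
      then show thesis
        using us p second by auto
    next
      case (Cons a us')
      then show thesis
        using us p l r by auto
    qed
  qed
  then show ?case
  proof cases
    case first
    then have "?R p q c"
      using P le matched_mono[OF P(1) le(1)] matched_mono[OF P(3) le(2)]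
      by (intro exI[of _ u] exI[of _ y0] exI[of _ v]) auto
    then show ?thesis ..
  next
    case l
    have *: "matched S \<rho> s ((x0, e0) # w @ (y0, \<not> e0) # v) c" if "matched S \<rho> s w a" for w
      using that P by (intro matched.Pair) auto
    from P(2)[OF l(2)] show ?thesis
    proof
      assume "?L p1 q1 a"
      then obtain p' y u where 1: "p1 = p' @ (y, \<not> e) # u" "y \<in> S" "\<rho> x y \<le> a"
        "matched S \<rho> s u a" "matched S \<rho> s (p' @ q1) a"
        by blast
      then have "?L p q c"
        using *[OF 1(5)] l le matched_mono[OF 1(4) le(1)]
        by (intro exI[of _ "(x0, e0) # p'"] exI[of _ y] exI[of _ u]) auto
      then show ?thesis ..
    next
      assume "?R p1 q1 a"
      then obtain q' y u where 1: "q1 = u @ (y, \<not> e) # q'" "y \<in> S" "\<rho> x y \<le> a"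
        "matched S \<rho> s u a" "matched S \<rho> s (p1 @ q') a"
        by blast
      then have "?R p q c"
        using *[OF 1(5)] l le matched_mono[OF 1(4) le(1)]
        by (intro exI[of _ "q' @ (y0, \<not> e0) # v"] exI[of _ y] exI[of _ u]) auto
      then show ?thesis ..
    qed
  next
    case second
    then have "?L p q c"
      using P le matched_mono[OF P(1) le(1)] matched_mono[OF P(3) le(2)]
      by (intro exI[of _ "[]"] exI[of _ x0] exI[of _ u]) (auto simp: commute)
    then show ?thesis ..
  next
    case r
    have *: "matched S \<rho> s ((x0, e0) # u @ (y0, \<not> e0) # w) c" if "matched S \<rho> s w b" for w
      using that P by (intro matched.Pair) auto
    from P(4)[OF r(2)] show ?thesis
    proof
      assume "?L p1 q b"
      then obtain p' y w where 1: "p1 = p' @ (y, \<not> e) # w" "y \<in> S" "\<rho> x y \<le> b"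
        "matched S \<rho> s w b" "matched S \<rho> s (p' @ q) b"
        by blast
      then have "?L p q c"
        using *[OF 1(5)] r le matched_mono[OF 1(4) le(2)]
        by (intro exI[of _ "(x0, e0) # u @ (y0, \<not> e0) # p'"] exI[of _ y] exI[of _ w]) auto
      then show ?thesis ..
    next
      assume "?R p1 q b"
      then obtain q' y w where 1: "q = w @ (y, \<not> e) # q'" "y \<in> S" "\<rho> x y \<le> b"
        "matched S \<rho> s w b" "matched S \<rho> s (p1 @ q') b"
        by blast
      then have "?R p q c"
        using *[OF 1(5)] r le matched_mono[OF 1(4) le(2)]
        by (intro exI[of _ q'] exI[of _ y] exI[of _ w]) auto
      then show ?thesis ..
    qed
  qed
qed auto

lemma matched_unweighted: "matched S \<rho> s w c \<Longrightarrow> matched S \<rho> (\<lambda>_. 1) w c"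
proof (induction rule: matched.induct)
  case (Pair u a v b x y c e)
  then show ?case
    using le_weight_mult[OF matched_nonneg[OF Pair.hyps(1)], of x]
    by (intro matched.Pair[of _ _ _ u a v b]) auto
qed (rule matched.Nil)

text \<open>Distinct letters are too far apart to be paired within the cost \<open>c\<close>. A
  noncrossing matching of equal letters with opposite signs cancels from the inside
  outwards.\<close>

lemma reduce_Nil_if_matched_separated:
  assumes "matched S \<rho> s w c"
    and "\<And>x y. x \<in> fst ` set w \<Longrightarrow> y \<in> fst ` set w \<Longrightarrow> x \<noteq> y \<Longrightarrow> c < \<rho> x y"
  shows "reduce w = []"
  using assms
proof (induction rule: matched.induct)
  case (Pair u a v b x y c e)
  have le: "a \<le> c" "b \<le> c" "\<rho> x y \<le> c"
    using Pair.hyps le_weight_mult[of a x] matched_nonneg[OF Pair.hyps(1)]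
      matched_nonneg[OF Pair.hyps(2)] nonneg[of x y] by linarith+
  have "y = x"
    using Pair.prems[of x y] le by fastforce
  moreover have "reduce u = []"
  proof (rule Pair.IH(1))
    fix x' y' assume "x' \<in> fst ` set u" "y' \<in> fst ` set u" "x' \<noteq> y'"
    then have "c < \<rho> x' y'"
      by (intro Pair.prems) auto
    then show "a < \<rho> x' y'"
      using le(1) by linarith
  qed
  moreover have "reduce v = []"
  proof (rule Pair.IH(2))
    fix x' y' assume "x' \<in> fst ` set v" "y' \<in> fst ` set v" "x' \<noteq> y'"
    then have "c < \<rho> x' y'"
      by (intro Pair.prems) auto
    then show "b < \<rho> x' y'"
      using le(2) by linarith
  qed
  moreover have "foldr cancel_cons u [(x, \<not> e)] = foldr cancel_cons (reduce u) [(x, \<not> e)]"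
    using foldr_reduce[of "[(x, \<not> e)]" u] by simp
  ultimately show ?case
    by (simp add: reduce_def inv_letter_def)
qed (simp add: reduce_def)

end

section \<open>Perturbing the letters of a word\<close>

context Metric_space
begin

definition close_words :: "real \<Rightarrow> 'a word \<Rightarrow> 'a word \<Rightarrow> bool" where
  "close_words \<delta> = list_all2 (\<lambda>a b. snd a = snd b \<and> fst a \<in> M \<and> fst b \<in> M \<and> d (fst a) (fst b) < \<delta>)"

text \<open>Each letter belongs to exactly one pair, so the same matching gets more expensive by at
  most \<open>\<delta>\<close> per letter.\<close>

lemma matched_close_words:
  assumes "matched M d (\<lambda>_. 1) w c" "close_words \<delta> w w'" 
  shows "matched M d (\<lambda>_. 1) w' (c + real (length w) * \<delta>)"
  using assms
proof (induction arbitrary: w' rule: matched.induct)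
  case (Nil c)
  then show ?case
    by (auto simp: close_words_def intro: matched.Nil)
next
  case (Pair u a v b x y c e)
  then obtain x' u' y' v' where w': "w' = (x', e) # u' @ (y', \<not> e) # v'"
    and close: "x' \<in> M" "y' \<in> M" "d x x' < \<delta>" "d y y' < \<delta>"
      "close_words \<delta> u u'" "close_words \<delta> v v'"
    by (auto simp: close_words_def list_all2_append1 list_all2_Cons1)
  have "d x' y' \<le> d x x' + d x y + d y y'"
    using triangle[of x' x y'] triangle[of x y y'] close Pair.hyps commute[of x x'] by simp
  then show ?case
    unfolding w' using Pair close
    by (intro matched.Pair[OF Pair.IH]) (auto simp: algebra_simps)
qed

end

section \<open>The weighted Graev topologies\<close>

lemma inv_word_inv_word [simp]: "inv_word (inv_word w) = w"
  by (simp add: inv_word_def rev_map o_def)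

lemma inv_free_group:
  assumes "w \<in> carrier (free_group S)"
  shows "inv\<^bsub>free_group S\<^esub> w = inv_word w"
proof -
  interpret F: group "free_group S" by (rule group_free_group)
  show ?thesis
    using assms inv_word_left[of "[]" w]
    by (intro F.inv_equality)
      (auto simp: carrier_free_group reduced_inv_word fst_inv_word reduce_def)
qed

lemma reduce_append_reduce: "reduce (u @ reduce v) = reduce (u @ v)"
  by (simp add: reduce_append reduce_reduced)

lemma reduce_reduce_append: "reduce (reduce u @ v) = reduce (u @ v)"
  by (simp add: reduce_append foldr_reduce)

lemma reduce_append_inv_word: "reduce (w @ inv_word w @ u) = reduce u"
  using inv_word_left[of "reduce u" "inv_word w"] by (simp add: reduce_append)

lemma not_reduced_cancelling_pair: "\<not> reduced_word (u @ (x, e) # (x, \<not> e) # v)"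
  by (auto simp: reduced_word_def successively_append_iff inv_letter_def)

context weighted_metric
begin

text \<open>The strict bound on \<open>c\<close> is what yields \<open>V_rounded\<close>, since
  \<open>matched\<close> is closed under enlarging the cost.\<close>

definition word_nbhd :: "real \<Rightarrow> 'a word set" where
  "word_nbhd \<epsilon> = {u \<in> carrier (free_group S). \<exists>c<\<epsilon>. matched S \<rho> s u c}"

lemma group_nbhd_base_word_nbhd: "group_nbhd_base (free_group S) word_nbhd"
proof -
  interpret F: group "free_group S" by (rule group_free_group)
  show ?thesis
  proof
    fix \<epsilon> :: real
    show "word_nbhd \<epsilon> \<subseteq> carrier (free_group S)"
      by (auto simp: word_nbhd_def)
  next
    fix \<epsilon> :: real assume "\<epsilon> > 0"
    then show "\<one>\<^bsub>free_group S\<^esub> \<in> word_nbhd \<epsilon>"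
      by (auto simp: word_nbhd_def carrier_free_group intro!: exI[of _ 0] matched.Nil)
  next
    fix \<delta> \<epsilon> :: real assume "\<delta> \<le> \<epsilon>"
    then show "word_nbhd \<delta> \<subseteq> word_nbhd \<epsilon>"
      by (force simp: word_nbhd_def)
  next
    fix u v \<delta> \<epsilon> assume "u \<in> word_nbhd \<delta>" "v \<in> word_nbhd \<epsilon>"
    then obtain a b where ab: "a < \<delta>" "matched S \<rho> s u a" "b < \<epsilon>" "matched S \<rho> s v b"
      and uv: "u \<in> carrier (free_group S)" "v \<in> carrier (free_group S)"
      by (auto simp: word_nbhd_def)
    have "matched S \<rho> s (reduce (u @ v)) (a + b)"
      using ab by (intro matched_reduce' matched_append) auto
    then show "u \<otimes>\<^bsub>free_group S\<^esub> v \<in> word_nbhd (\<delta> + \<epsilon>)"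
      using ab uv by (auto simp: word_nbhd_def reduce_closed intro!: exI[of _ "a + b"])
  next
    fix u \<epsilon> assume u: "u \<in> word_nbhd \<epsilon>"
    then have "inv\<^bsub>free_group S\<^esub> u \<in> carrier (free_group S)"
      by (simp add: word_nbhd_def)
    with u show "inv\<^bsub>free_group S\<^esub> u \<in> word_nbhd \<epsilon>"
      using matched_inv_word by (auto simp: word_nbhd_def inv_free_group)
    obtain c where "c < \<epsilon>" "matched S \<rho> s u c"
      using u by (auto simp: word_nbhd_def)
    moreover obtain \<delta> where "c < \<delta>" "\<delta> < \<epsilon>"
      using \<open>c < \<epsilon>\<close> dense by blast
    ultimately show "\<exists>\<delta><\<epsilon>. u \<in> word_nbhd \<delta>"
      using u by (auto simp: word_nbhd_def)
  next
    fix g and \<epsilon> :: real assume g: "g \<in> carrier (free_group S)" and \<epsilon>: "\<epsilon> > 0"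
    then obtain C where C: "C > 0"
      "\<And>v c. matched S \<rho> s v c \<Longrightarrow> matched S \<rho> s (g @ v @ inv_word g) (C * c)"
      using matched_conj[of g] by (auto simp: carrier_free_group)
    have "g \<otimes>\<^bsub>free_group S\<^esub> v \<otimes>\<^bsub>free_group S\<^esub> inv\<^bsub>free_group S\<^esub> g \<in> word_nbhd \<epsilon>"
      if v: "v \<in> word_nbhd (\<epsilon> / C)" for v
    proof -
      obtain c where c: "c < \<epsilon> / C" "matched S \<rho> s v c"
        using v by (auto simp: word_nbhd_def)
      have "matched S \<rho> s (reduce (g @ v @ inv_word g)) (C * c)"
        using C(2)[OF c(2)] by (rule matched_reduce')
      moreover have "C * c < \<epsilon>"
        using c(1) C(1) by (simp add: field_simps)
      moreover have "g \<otimes>\<^bsub>free_group S\<^esub> v \<otimes>\<^bsub>free_group S\<^esub> inv\<^bsub>free_group S\<^esub> g \<in> carrier (free_group S)"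
        using v g by (intro F.m_closed F.inv_closed) (auto simp: word_nbhd_def)
      ultimately show ?thesis
        using g by (auto simp: word_nbhd_def inv_free_group reduce_reduce_append)
    qed
    then show "\<exists>\<delta>>0. \<forall>v\<in>word_nbhd \<delta>.
        g \<otimes>\<^bsub>free_group S\<^esub> v \<otimes>\<^bsub>free_group S\<^esub> inv\<^bsub>free_group S\<^esub> g \<in> word_nbhd \<epsilon>"
      using \<epsilon> C(1) by (intro exI[of _ "\<epsilon> / C"]) auto
  qed
qed

text \<open>The free topology is the finest group topology making \<open>gen\<close> continuous. For
  the weighted topology continuity of \<open>gen\<close> needs locally constant weights, because
  \<open>x\<close> and \<open>y\<close> can be paired only if \<open>s x = s y\<close>.\<close>

lemma openin_free_group_topology_word_nbhd:
  assumes T: "free_group_topology mtopology T"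
    and weight: "\<And>x. x \<in> S \<Longrightarrow> \<exists>\<delta>>0. \<forall>y\<in>S. \<rho> x y < \<delta> \<longrightarrow> s y = s x"
    and w: "w \<in> carrier (free_group S)"
  shows "openin T {u \<in> carrier (free_group S). reduce (inv_word w @ u) \<in> word_nbhd \<epsilon>}"
proof -
  interpret F: group_nbhd_base "free_group S" word_nbhd
    by (rule group_nbhd_base_word_nbhd)
  have "continuous_map mtopology F.V_topology gen"
    unfolding continuous_map_def
  proof (intro conjI allI impI)
    fix U assume U: "openin F.V_topology U"
    show "openin mtopology {x \<in> topspace mtopology. gen x \<in> U}"
      unfolding openin_mtopology
    proof (intro conjI allI impI)
      fix x assume x: "x \<in> {x \<in> topspace mtopology. gen x \<in> U}"
      obtain \<epsilon> where \<epsilon>: "\<epsilon> > 0"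
        "{h \<in> carrier (free_group S). inv\<^bsub>free_group S\<^esub> gen x \<otimes>\<^bsub>free_group S\<^esub> h \<in> word_nbhd \<epsilon>} \<subseteq> U"
        using F.V_topology_nbhd[OF U] x by blast
      obtain \<delta> where \<delta>: "\<delta> > 0" "\<forall>y\<in>S. \<rho> x y < \<delta> \<longrightarrow> s y = s x"
        using weight x by auto
      have "gen y \<in> U" if y: "y \<in> S" "\<rho> x y < \<delta>" "\<rho> x y < \<epsilon>" for y
      proof -
        have "matched S \<rho> s ((x, False) # [] @ [(y, \<not> False)]) (\<rho> x y)"
          using y x \<delta>(2) by (intro matched_wrap[where a = 0] matched.Nil) auto
        then have "matched S \<rho> s (inv_word (gen x) @ gen y) (\<rho> x y)"
          by (simp add: inv_word_def gen_def inv_letter_def)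
        then have "reduce (inv_word (gen x) @ gen y) \<in> word_nbhd \<epsilon>"
          using x y reduce_closed[of "inv_word (gen x)" S "gen y"] matched_reduce'
          by (auto simp: word_nbhd_def carrier_free_group fst_inv_word reduced_inv_word gen_def)
        then show ?thesis
          using \<epsilon>(2) x y by (auto simp: inv_free_group)
      qed
      then show "\<exists>r>0. mball x r \<subseteq> {x \<in> topspace mtopology. gen x \<in> U}"
        using \<delta>(1) \<epsilon>(1) by (intro exI[of _ "min \<delta> \<epsilon>"]) auto
    qed auto
  qed (auto simp: F.topspace_V_topology)
  then have "continuous_map T F.V_topology id"
    using free_group_topology_finest[OF T] F.topological_group_V by simp
  then have "openin T U" if "openin F.V_topology U" for U
    using that topology_finer_continuous_id T F.topspace_V_topology
    unfolding free_group_topology_def topological_group_def by (metis topspace_mtopology)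
  from this[OF F.openin_V_translate[OF w, of \<epsilon>]] show ?thesis
    using w by (simp add: inv_free_group)
qed

text \<open>Recovers the letters of \<open>u\<close> that were lost in the reduction:
  \<open>inv_word w @ w\<close> has a matching of cost 0, so it can be put in front, and then
  \<open>w\<close> times the reduced word is reduced back to \<open>u\<close>.\<close>

lemma matched_translate:
  assumes "matched S \<rho> s (reduce (inv_word w @ u)) c" "w \<in> carrier (free_group S)" "reduced_word u"
  shows "matched S \<rho> s (inv_word w @ u) c"
proof -
  have "fst ` set (inv_word w) \<subseteq> S"
    using assms(2) by (simp add: carrier_free_group fst_inv_word)
  then have "matched S \<rho> s (inv_word w @ [] @ inv_word (inv_word w)) 0"
    using matched_conj[of "inv_word w"] matched.Nil[of 0 S \<rho> s] by (metis mult_zero_right order_refl)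
  then have "matched S \<rho> s ((inv_word w @ w) @ reduce (inv_word w @ u)) c"
    using matched_append[of "inv_word w @ w" 0, OF _ assms(1)] by simp
  then have "matched S \<rho> s (inv_word w @ reduce (w @ reduce (inv_word w @ u))) c"
    using matched_reduce[of "inv_word w" "w @ reduce (inv_word w @ u)" "[]"] by simp
  then show ?thesis
    using assms(3) by (simp add: reduce_append_reduce reduce_append_inv_word reduce_reduced)
qed

section \<open>Matchings of reduced words with at most four letters\<close>

lemma matched_pair:
  assumes "matched S \<rho> s w c" "length w = 2"
  obtains x y e where "w = [(x, e), (y, \<not> e)]" "x \<in> S" "y \<in> S" "\<rho> x y \<le> c"
  using assms(1)
proof (cases rule: matched.cases)
  case (Pair u a v b x y e)
  then have "u = []" "v = []"
    using assms(2) by auto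
  moreover have "\<rho> x y \<le> c"
    using Pair matched_nonneg[OF Pair(2)] matched_nonneg[OF Pair(3)] le_weight_mult[of a x] by linarith
  ultimately show ?thesis
    using that Pair by auto
qed (use assms(2) in auto)

text \<open>Adjacent partners in a reduced word are distinct, so their distance bounds
  \<open>k\<close> at both. Only a pair enclosing two further letters can consist of equal letters,
  and there its weight enters the cost.\<close>

lemma matched_short:
  assumes m: "matched S \<rho> s w c" and red: "reduced_word w" and len: "length w \<le> 4"
    and k: "\<And>x y. x \<in> S \<Longrightarrow> y \<in> S \<Longrightarrow> x \<noteq> y \<Longrightarrow> k x \<le> \<rho> x y"
  shows "(\<forall>x\<in>fst ` set w. k x \<le> c) \<or>
    (\<exists>x e y f z. w = [(x, e), (y, f), (z, \<not> f), (x, \<not> e)] \<and>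
       x \<in> S \<and> y \<in> S \<and> z \<in> S \<and> y \<noteq> z \<and> s x * \<rho> y z \<le> c)"
  using m
proof (cases rule: matched.cases)
  case (Pair u a v b x y e)
  have k': "k x \<le> \<rho> x y" "k y \<le> \<rho> x y" if "x \<in> S" "y \<in> S" "x \<noteq> y" for x y
    using k[of x y] k[of y x] that by (auto simp: commute)
  have ab: "0 \<le> a" "0 \<le> b" "a \<le> s x * a"
    using Pair matched_nonneg le_weight_mult by auto
  then have le: "s x * a \<le> c" "b \<le> c" "\<rho> x y \<le> c" "a \<le> c"
    using Pair(7) nonneg[of x y] by linarith+
  have ev: "even (length u)" "even (length v)"
    using Pair even_length_matched by auto
  have "length u + length v \<le> 2"
    using len Pair(1) by simp
  with ev have "length u = 0 \<and> length v = 0 \<or> length u = 0 \<and> length v = 2 \<or>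
      length u = 2 \<and> length v = 0"
    by presburger
  then consider "u = []" "v = []" | "u = []" "length v = 2" | "length u = 2" "v = []"
    by auto
  then show ?thesis
  proof cases
    case 1
    then have "x \<noteq> y"
      using red Pair(1) by (auto simp: reduced_Cons2 inv_letter_def)
    then show ?thesis
      using 1 k'[of x y] Pair le by fastforce
  next
    case 2
    then obtain z z' f where v: "v = [(z, f), (z', \<not> f)]" "z \<in> S" "z' \<in> S" "\<rho> z z' \<le> b"
      using matched_pair[OF Pair(3)] by blast
    have "x \<noteq> y" "z \<noteq> z'"
      using red Pair(1) 2 v(1) by (auto simp: reduced_Cons2 inv_letter_def)
    then show ?thesis
      using 2 v k'[of x y] k'[of z z'] Pair le by fastforce
  next
    case 3
    then obtain z z' f where u: "u = [(z, f), (z', \<not> f)]" "z \<in> S" "z' \<in> S" "\<rho> z z' \<le> a"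
      using matched_pair[OF Pair(2)] by blast
    have zz: "z \<noteq> z'"
      using red Pair(1) 3 u(1) by (auto simp: reduced_Cons2 inv_letter_def)
    show ?thesis
    proof (cases "x = y")
      case True
      have "s x * \<rho> z z' \<le> s x * a"
        using u(4) weight_ge_1[of x] by (intro mult_left_mono) auto
      then have "s x * \<rho> z z' \<le> c"
        using le by linarith
      then show ?thesis
        using 3 u Pair True zz by auto
    next
      case False
      then show ?thesis
        using 3 u k'[of x y] k'[of z z'] Pair le zz by fastforce
    qed
  qed
qed auto

text \<open>For a nontrivial \<open>w\<close> the exceptional shape of \<open>matched_short\<close>
  does not arise: the partner of \<open>x\<close> is a letter of \<open>w\<close>, or a letter of
  \<open>u\<close> different from \<open>x\<close>.\<close>

lemma matched_near_word:
  assumes m: "matched S \<rho> s (inv_word w @ u) c" and red: "reduced_word u" and len: "length u \<le> 4"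
    and k: "\<And>x y. x \<in> S \<Longrightarrow> y \<in> S \<Longrightarrow> x \<noteq> y \<Longrightarrow> k x \<le> \<rho> x y"
    and w: "reduced_word w" "w \<noteq> []"
    and sep: "\<And>x y. x \<in> fst ` set w \<Longrightarrow> y \<in> fst ` set w \<Longrightarrow> x \<noteq> y \<Longrightarrow> c < \<rho> x y"
    and x: "x \<in> fst ` set u"
  shows "k x \<le> c \<or> (\<exists>q\<in>fst ` set w. \<rho> q x \<le> c)"
proof -
  have no: "\<not> matched S \<rho> s (inv_word w) c"
  proof
    assume "matched S \<rho> s (inv_word w) c"
    then have "reduce (inv_word w) = []"
      by (rule reduce_Nil_if_matched_separated) (auto simp: fst_inv_word intro: sep)
    then show False
      using w by (simp add: reduce_reduced reduced_inv_word) (simp add: inv_word_def)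
  qed
  have xS: "x \<in> S"
    using matched_carrier[OF m] x by auto
  \<comment> \<open>Equal partners within \<open>u\<close> enclose a nonempty word of even length.
    As \<open>u\<close> has at most four letters, nothing of \<open>u\<close> remains outside, so
    \<open>inv_word w\<close> would be matched by itself.\<close>
  have inner: "y \<noteq> z" if u: "u = u1 @ (y, \<not> e) # v @ (z, e) # u2" and v: "matched S \<rho> s v c"
    and rest: "matched S \<rho> s (inv_word w @ u1 @ u2) c" for u1 y e v z u2
  proof
    assume "y = z"
    then have "v \<noteq> []"
      using red u not_reduced_cancelling_pair[of u1 z "\<not> e"] by auto
    moreover have "even (length v)"
      using v by (rule even_length_matched)
    ultimately have "length v \<ge> 2"
      by (cases v) (auto elim!: oddE)
    moreover have "length u = length u1 + length v + length u2 + 2"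
      by (simp add: u)
    ultimately have "length u1 + length u2 = 0"
      using len by linarith
    then have "u1 = []" "u2 = []"
      by auto
    then show False
      using no rest by simp
  qed
  obtain e where "(x, e) \<in> set u"
    using x by force
  then obtain u1 u2 where u: "u = u1 @ (x, e) # u2"
    by (meson split_list)
  with m have "matched S \<rho> s ((inv_word w @ u1) @ (x, e) # u2) c"
    by simp
  from matched_partner[OF this] show ?thesis
  proof (elim disjE exE conjE)
    fix p' y v
    assume p: "inv_word w @ u1 = p' @ (y, \<not> e) # v" and y: "y \<in> S" "\<rho> x y \<le> c"
      and v: "matched S \<rho> s v c" "matched S \<rho> s (p' @ u2) c"
    have "(y, \<not> e) \<in> set (inv_word w) \<or> (\<exists>v1. p' = inv_word w @ v1 \<and> u1 = v1 @ (y, \<not> e) # v)"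
    proof -
      from p obtain us where us: "inv_word w = p' @ us \<and> us @ u1 = (y, \<not> e) # v \<or>
          inv_word w @ us = p' \<and> u1 = us @ (y, \<not> e) # v"
        unfolding append_eq_append_conv2 by blast
      then show ?thesis
        by (cases us) auto
    qed
    then show ?thesis
    proof
      assume "(y, \<not> e) \<in> set (inv_word w)"
      then have "y \<in> fst ` set w"
        using fst_inv_word[of w] by force
      then show ?thesis
        using y by (auto simp: commute)
    next
      assume "\<exists>v1. p' = inv_word w @ v1 \<and> u1 = v1 @ (y, \<not> e) # v"
      then obtain v1 where v1: "p' = inv_word w @ v1" "u1 = v1 @ (y, \<not> e) # v" by blast
      have "y \<noteq> x"
        using inner[of v1 y e v x u2] u v v1 by simp
      then show ?thesis
        using k[of x y] xS y by force
    qed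
  next
    fix v y q'
    assume q: "u2 = v @ (y, \<not> e) # q'" and y: "y \<in> S" "\<rho> x y \<le> c"
      and v: "matched S \<rho> s v c" "matched S \<rho> s ((inv_word w @ u1) @ q') c"
    have "x \<noteq> y"
      using inner[of u1 x "\<not> e" v y q'] u v q by simp
    then show ?thesis
      using k[of x y] xS y by force
  qed
qed

end

section \<open>Convergence of words\<close>

lemma constant_subseq:
  fixes f :: "nat \<Rightarrow> 'b"
  assumes "finite (range f)"
  obtains r c where "strict_mono (r :: nat \<Rightarrow> nat)" "\<forall>n. f (r n) = c"
proof -
  obtain N where N: "infinite {n. f n = f N}"
    using pigeonhole_infinite[of "UNIV :: nat set" f] assms by auto
  then show ?thesis
    using that[of "enumerate {n. f n = f N}" "f N"] strict_mono_enumerate enumerate_in_set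
    by blast
qed

context Metric_space
begin

text \<open>This is satisfied by the distance to a nonempty compact set.\<close>

definition proper_at_0 :: "('a \<Rightarrow> real) \<Rightarrow> bool" where
  "proper_at_0 k \<longleftrightarrow> (\<forall>x. 0 \<le> k x) \<and> (\<forall>\<sigma>. range \<sigma> \<subseteq> M \<longrightarrow> (\<lambda>n. k (\<sigma> n)) \<longlonglongrightarrow> 0 \<longrightarrow>
     (\<exists>a\<in>M. \<exists>r. strict_mono r \<and> limitin mtopology (\<sigma> \<circ> r) a sequentially))"

text \<open>\<open>Q\<close> holds the finitely many letters to be tolerated besides those where
  \<open>k\<close> is small: the letters of \<open>w\<close>, or the conjugating letter of an
  exceptional word.\<close>

definition near :: "('a \<Rightarrow> real) \<Rightarrow> 'a set \<Rightarrow> nat \<Rightarrow> 'a \<Rightarrow> bool" where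
  "near k Q n x \<longleftrightarrow> x \<in> M \<and> (k x < inverse (Suc n) \<or> (\<exists>q\<in>Q. d q x < inverse (Suc n)))"

lemma near_antimono: "near k Q n x \<Longrightarrow> m \<le> n \<Longrightarrow> near k Q m x"
proof -
  assume "near k Q n x" "m \<le> n"
  moreover from this have "inverse (real (Suc n)) \<le> inverse (real (Suc m))"
    by (intro le_imp_inverse_le) auto
  ultimately show ?thesis
    unfolding near_def by (meson less_le_trans)
qed

lemma near_convergent_subseq:
  assumes k: "proper_at_0 k"
    and Q: "finite Q" "Q \<subseteq> M" and x: "\<And>n. near k Q n (x n)"
  obtains a r where "a \<in> M" "strict_mono (r :: nat \<Rightarrow> nat)"
    "limitin mtopology (x \<circ> r) a sequentially"
proof -
  \<comment> \<open>\<open>f n\<close> records why \<open>x n\<close> is \<open>near\<close>. It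
    takes finitely many values, so one reason persists along a subsequence.\<close>
  define f where "f n = (if k (x n) < inverse (Suc n) then None
      else Some (SOME q. q \<in> Q \<and> d q (x n) < inverse (Suc n)))" for n
  have Some: "q \<in> Q \<and> d q (x n) < inverse (Suc n)" if "f n = Some q" for n q
    using that x[of n] someI_ex[of "\<lambda>q. q \<in> Q \<and> d q (x n) < inverse (Suc n)"]
    by (auto simp: f_def near_def split: if_splits)
  have "range f \<subseteq> insert None (Some ` Q)"
    using Some by (metis imageI insert_iff not_Some_eq image_subsetI)
  then have "finite (range f)"
    using Q(1) finite_subset by blast
  then obtain r :: "nat \<Rightarrow> nat" and c where r: "strict_mono r" "\<forall>n. f (r n) = c"
    by (rule constant_subseq)
  have lim: "(\<lambda>n. inverse (real (Suc (r n)))) \<longlonglongrightarrow> 0"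
    using LIMSEQ_subseq_LIMSEQ[OF LIMSEQ_inverse_real_of_nat r(1)] by (simp add: o_def)
  have xM: "x n \<in> M" for n
    using x[of n] by (simp add: near_def)
  show ?thesis
  proof (cases c)
    case None
    have "k (x (r n)) < inverse (real (Suc (r n)))" for n
      using spec[OF r(2), of n] None by (auto simp: f_def split: if_splits)
    then have "(\<lambda>n. k (x (r n))) \<longlonglongrightarrow> 0"
      using k unfolding proper_at_0_def by (intro tendsto_sandwich[OF _ _ tendsto_const lim])
        (auto intro!: always_eventually less_imp_le)
    then obtain a r' where "a \<in> M" "strict_mono r'" "limitin mtopology ((x \<circ> r) \<circ> r') a sequentially"
      using k xM unfolding proper_at_0_def by (auto dest!: spec[of _ "x \<circ> r"])
    then show ?thesis
      using that[of a "r \<circ> r'"] r(1) by (simp add: strict_mono_o o_assoc)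
  next
    case (Some q)
    have q: "q \<in> Q" "d q (x (r n)) < inverse (real (Suc (r n)))" for n
      using \<open>\<And>n q. f n = Some q \<Longrightarrow> _ n q\<close> spec[OF r(2), of n] Some by auto
    have "(\<lambda>n. d (x (r n)) q) \<longlonglongrightarrow> 0"
      using q(2) by (intro tendsto_sandwich[OF _ _ tendsto_const lim])
        (auto intro!: less_imp_le always_eventually simp: commute)
    then have "limitin mtopology (x \<circ> r) q sequentially"
      using q(1) Q(2) xM by (auto simp: limitin_metric_dist_null o_def)
    then show ?thesis
      using that q(1) Q(2) r(1) by blast
  qed
qed

text \<open>Passes to a subsequence once for every letter of the common sign pattern
  \<open>es\<close>. The limit \<open>P\<close> need not be reduced, even if all \<open>W n\<close>
  are.\<close>

lemma near_words_convergent_subseq: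
  assumes k: "proper_at_0 k"
    and Q: "finite Q" "Q \<subseteq> M"
    and W: "\<And>n. map snd (W n) = es" "\<And>n x. x \<in> fst ` set (W n) \<Longrightarrow> near k Q n x"
  shows "\<exists>r P. strict_mono (r :: nat \<Rightarrow> nat) \<and> fst ` set P \<subseteq> M \<and>
    (\<forall>\<delta>>0. \<forall>\<^sub>F n in sequentially. close_words \<delta> (W (r n)) P)"
  using W
proof (induction es arbitrary: W)
  case Nil
  then show ?case
    by (intro exI[of _ id] exI[of _ "[]"]) (auto simp: close_words_def strict_mono_def)
next
  case (Cons e es)
  define x where "x n = fst (hd (W n))" for n
  define W' where "W' n = tl (W n)" for n
  have W: "W n = (x n, e) # W' n" for n
    using Cons.prems(1)[of n] by (cases "W n") (auto simp: x_def W'_def)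
  obtain a r where a: "a \<in> M" "strict_mono r" "limitin mtopology (x \<circ> r) a sequentially"
    using near_convergent_subseq[OF k Q, of x] Cons.prems(2) W by auto
  have "\<exists>r' P. strict_mono (r' :: nat \<Rightarrow> nat) \<and> fst ` set P \<subseteq> M \<and>
      (\<forall>\<delta>>0. \<forall>\<^sub>F n in sequentially. close_words \<delta> ((W' \<circ> r) (r' n)) P)"
  proof (rule Cons.IH)
    show "map snd ((W' \<circ> r) n) = es" for n
      using Cons.prems(1)[of "r n"] W[of "r n"] by simp
    show "near k Q n x" if "x \<in> fst ` set ((W' \<circ> r) n)" for n x
      using Cons.prems(2)[of x "r n"] that W[of "r n"] seq_suble[OF a(2), of n]
      by (auto intro: near_antimono)
  qed
  then obtain r' P where r': "strict_mono r'" "fst ` set P \<subseteq> M"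
    "\<And>\<delta>. \<delta> > 0 \<Longrightarrow> \<forall>\<^sub>F n in sequentially. close_words \<delta> (W' (r (r' n))) P"
    by auto
  have "\<forall>\<^sub>F n in sequentially. close_words \<delta> (W (r (r' n))) ((a, e) # P)" if "\<delta> > 0" for \<delta>
  proof -
    have "limitin mtopology ((x \<circ> r) \<circ> r') a sequentially"
      using a(3) r'(1) by (rule limitin_subsequence[rotated])
    then have "\<forall>\<^sub>F n in sequentially. x (r (r' n)) \<in> M \<and> d (x (r (r' n))) a < \<delta>"
      using that by (simp add: limitin_metric)
    with r'(3)[OF that] show ?thesis
      by eventually_elim (use W a(1) in \<open>auto simp: close_words_def\<close>)
  qed
  then show ?case
    using a r' by (intro exI[of _ "r \<circ> r'"] exI[of _ "(a, e) # P"]) (auto simp: strict_mono_def)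
qed

lemma finite_separated:
  assumes "finite F" "F \<subseteq> M"
  obtains \<eta> where "\<eta> > 0" "\<And>x y. x \<in> F \<Longrightarrow> y \<in> F \<Longrightarrow> x \<noteq> y \<Longrightarrow> \<eta> \<le> d x y"
proof -
  \<comment> \<open>The extra element 1 keeps \<open>D\<close> nonempty when \<open>F\<close> has at
    most one point.\<close>
  define D where "D = insert 1 ((\<lambda>(x, y). d x y) ` {(x, y) \<in> F \<times> F. x \<noteq> y})"
  have "finite {(x, y) \<in> F \<times> F. x \<noteq> y}"
    by (rule finite_subset[OF _ finite_cartesian_product[OF assms(1) assms(1)]]) auto
  then have D: "finite D" "D \<noteq> {}"
    by (auto simp: D_def)
  have "z > 0" if "z \<in> D" for z
    using that assms(2) by (auto simp: D_def subset_iff)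
  then have "Min D > 0"
    using D by simp
  moreover have "Min D \<le> d x y" if "x \<in> F" "y \<in> F" "x \<noteq> y" for x y
    using D that by (intro Min_le) (auto simp: D_def)
  ultimately show ?thesis
    using that by blast
qed

text \<open>For a fixed sign pattern the group element is a continuous function of the letters;
  multiplication is used once per letter.\<close>

lemma reduce_continuous:
  assumes T: "topological_group (free_group M) T" and gen: "continuous_map mtopology T gen"
    and U: "openin T U" "reduce P \<in> U" and P: "fst ` set P \<subseteq> M"
  obtains \<delta> where "\<delta> > 0" "\<And>W. close_words \<delta> W P \<Longrightarrow> reduce W \<in> U"
proof -
  have "\<exists>\<delta>>0. \<forall>W. close_words \<delta> W P \<longrightarrow> reduce W \<in> U"
    using U P
  proof (induction P arbitrary: U)
    case Nil
    then show ?case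
      by (intro exI[of _ 1]) (auto simp: close_words_def)
  next
    case (Cons z P)
    obtain x e where z: "z = (x, e)" by fastforce
    have TM: "topspace T = carrier (free_group M)"
      and mul: "continuous_map (prod_topology T T) T (\<lambda>(u, v). reduce (u @ v))"
      and inv: "continuous_map T T (\<lambda>u. inv\<^bsub>free_group M\<^esub> u)"
      using T by (auto simp: topological_group_def)
    have letter: "continuous_map mtopology T (\<lambda>y. [(y, e)])"
    proof (cases e)
      case True
      then show ?thesis
        using gen by (simp add: gen_def[abs_def])
    next
      case False
      from continuous_map_compose[OF gen inv] show ?thesis
        by (rule continuous_map_eq)
          (auto simp: inv_free_group False, auto simp: gen_def inv_word_def inv_letter_def)
    qed
    have "([(x, e)], reduce P) \<in> topspace (prod_topology T T)"
      using Cons.prems z set_reduce[of P] by (auto simp: TM carrier_free_group)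
    moreover have "reduce ([(x, e)] @ reduce P) \<in> U"
      using Cons.prems(2) z by (simp only: reduce_append_reduce) simp
    ultimately have "([(x, e)], reduce P) \<in> {p \<in> topspace (prod_topology T T).
        (case p of (u, v) \<Rightarrow> reduce (u @ v)) \<in> U}"
      by simp
    then obtain A B where AB: "openin T A" "openin T B" "[(x, e)] \<in> A" "reduce P \<in> B"
      "A \<times> B \<subseteq> {p \<in> topspace (prod_topology T T). (case p of (u, v) \<Rightarrow> reduce (u @ v)) \<in> U}"
      using openin_continuous_map_preimage[OF mul Cons.prems(1)]
      unfolding openin_prod_topology_alt by meson
    obtain \<delta>1 where \<delta>1: "\<delta>1 > 0" "\<forall>W. close_words \<delta>1 W P \<longrightarrow> reduce W \<in> B"
      using Cons.IH[OF AB(2,4)] Cons.prems(3) by auto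
    have "openin mtopology {y \<in> topspace mtopology. [(y, e)] \<in> A}"
      using openin_continuous_map_preimage[OF letter AB(1)] .
    then obtain \<delta>2 where \<delta>2: "\<delta>2 > 0" "mball x \<delta>2 \<subseteq> {y \<in> topspace mtopology. [(y, e)] \<in> A}"
      using AB(3) Cons.prems(3) z unfolding openin_mtopology by auto
    have "reduce W \<in> U" if close: "close_words (min \<delta>1 \<delta>2) W (z # P)" for W
    proof -
      obtain y W' where W: "W = (y, e) # W'" "y \<in> M" "x \<in> M" "d y x < \<delta>1" "d y x < \<delta>2"
        and W': "close_words (min \<delta>1 \<delta>2) W' P"
        using close z by (fastforce simp: close_words_def list_all2_Cons2)
      have "close_words \<delta>1 W' P"
        using W' unfolding close_words_def by (rule list_all2_mono) auto
      then have "reduce W' \<in> B"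
        using \<delta>1(2) by blast
      moreover have "[(y, e)] \<in> A"
        using \<delta>2(2) W by (auto simp: commute)
      ultimately have "reduce ([(y, e)] @ reduce W') \<in> U"
        using AB(5) by auto
      then show ?thesis
        using W(1) by (simp only: reduce_append_reduce) simp
    qed
    then show ?case
      using \<delta>1(1) \<delta>2(1) by (intro exI[of _ "min \<delta>1 \<delta>2"]) auto
  qed
  then show ?thesis
    using that by blast
qed

lemma close_words_refl: "fst ` set w \<subseteq> M \<Longrightarrow> \<delta> > 0 \<Longrightarrow> close_words \<delta> w w"
  unfolding close_words_def by (rule list.rel_refl_strong) auto

text \<open>Along a subsequence the signs are constant and the letters converge to a word
  \<open>P\<close>. The word \<open>inv_word w @ P\<close> inherits matchings cheaper than the
  distances between its letters, hence reduces to the identity, so \<open>P\<close> represents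
  \<open>w\<close>.\<close>

lemma matched_convergent_subseq:
  assumes k: "proper_at_0 k"
    and T: "topological_group (free_group M) T" and gen: "continuous_map mtopology T gen"
    and w: "w \<in> carrier (free_group M)" and Q: "finite Q" "Q \<subseteq> M"
    and u: "\<And>n. u n \<in> words_upto M N"
    and near: "\<And>n x. x \<in> fst ` set (u n) \<Longrightarrow> near k Q n x"
    and m: "\<And>n. matched M d (\<lambda>_. 1) (inv_word w @ u n) (inverse (Suc n))"
  obtains r where "strict_mono (r :: nat \<Rightarrow> nat)" "limitin T (u \<circ> r) w sequentially"
proof -
  interpret W: weighted_metric M d "\<lambda>_. 1"
    by unfold_locales simp
  have "range (\<lambda>n. map snd (u n)) \<subseteq> {es. set es \<subseteq> (UNIV :: bool set) \<and> length es \<le> N}"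
    using u by (auto simp: words_upto_def)
  then have "finite (range (\<lambda>n. map snd (u n)))"
    using finite_lists_length_le[of "UNIV :: bool set" N] finite_subset by auto
  then obtain r1 :: "nat \<Rightarrow> nat" and es where r1: "strict_mono r1" "\<forall>n. map snd (u (r1 n)) = es"
    by (rule constant_subseq)
  have "near k Q n x" if "x \<in> fst ` set ((u \<circ> r1) n)" for n x
    using near[of x "r1 n"] that seq_suble[OF r1(1), of n] by (auto intro: near_antimono)
  with near_words_convergent_subseq[OF k Q, of "u \<circ> r1" es] r1(2)
  obtain r2 P where r2: "strict_mono r2" "fst ` set P \<subseteq> M"
    and close: "\<And>\<delta>. \<delta> > 0 \<Longrightarrow> \<forall>\<^sub>F n in sequentially. close_words \<delta> (u (r1 (r2 n))) P"
    by auto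
  define r where "r = r1 \<circ> r2"
  have r: "strict_mono r"
    using r1 r2 by (simp add: r_def strict_mono_o)
  define L where "L = inv_word w @ P"
  have wM: "fst ` set (inv_word w) \<subseteq> M" and red: "reduced_word w"
    using w by (auto simp: carrier_free_group fst_inv_word)
  then have "fst ` set L \<subseteq> M"
    using r2(2) by (auto simp: L_def)
  then obtain \<eta> where \<eta>: "\<eta> > 0"
    "\<And>x y. x \<in> fst ` set L \<Longrightarrow> y \<in> fst ` set L \<Longrightarrow> x \<noteq> y \<Longrightarrow> \<eta> \<le> d x y"
    using finite_separated[of "fst ` set L"] by auto
  \<comment> \<open>The cost of \<open>L\<close> will be bounded by
    \<open>inverse (Suc (r n)) + length L * \<delta>\<close>, both summands below
    \<open>\<eta> / 2\<close>. The \<open>+ 1\<close> covers an empty \<open>L\<close>.\<close>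
  define \<delta> where "\<delta> = \<eta> / (2 * (real (length L) + 1))"
  have \<delta>: "\<delta> > 0" "real (length L) * \<delta> < \<eta> / 2"
    using \<eta>(1) by (auto simp: \<delta>_def field_simps)
  have "\<forall>\<^sub>F n in sequentially. inverse (real (Suc (r n))) < \<eta> / 2"
    using LIMSEQ_subseq_LIMSEQ[OF LIMSEQ_inverse_real_of_nat r] \<eta>(1)
    by (intro order_tendstoD(2)) (auto simp: o_def)
  with close[OF \<delta>(1)] obtain n where n: "close_words \<delta> (u (r n)) P"
    "inverse (real (Suc (r n))) < \<eta> / 2"
    using eventually_happens[OF eventually_conj] by (fastforce simp: r_def)
  have "close_words \<delta> (inv_word w @ u (r n)) L"
    using n(1) close_words_refl[OF wM \<delta>(1)] by (simp add: L_def close_words_def list_all2_appendI)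
  moreover from this have "length (inv_word w @ u (r n)) = length L"
    unfolding close_words_def by (rule list_all2_lengthD)
  ultimately have "matched M d (\<lambda>_. 1) L (inverse (Suc (r n)) + real (length L) * \<delta>)"
    using matched_close_words[OF m] by metis
  then have "reduce L = []"
    using n(2) \<delta>(2) \<eta>(2) by (intro W.reduce_Nil_if_matched_separated) fastforce+
  then have P: "reduce P = w"
    using reduce_append_inv_word[of w P] reduce_append_reduce[of w L] red
    by (simp add: L_def reduce_reduced)
  have "limitin T (u \<circ> r) w sequentially"
    unfolding limitin_def
  proof (intro conjI allI impI)
    show "w \<in> topspace T"
      using T w by (simp add: topological_group_def)
    fix U assume U: "openin T U \<and> w \<in> U"
    then obtain \<epsilon> where \<epsilon>: "\<epsilon> > 0" "\<And>W. close_words \<epsilon> W P \<Longrightarrow> reduce W \<in> U"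
      using reduce_continuous[OF T gen _ _ r2(2), of U] P by auto
    have red: "reduce (u n) = u n" for n
      using u[of n] by (simp add: words_upto_def carrier_free_group reduce_reduced)
    from close[OF \<epsilon>(1)] show "\<forall>\<^sub>F n in sequentially. (u \<circ> r) n \<in> U"
    proof eventually_elim
      case (elim n)
      then show ?case
        using \<epsilon>(2)[OF elim] red by (simp add: r_def)
    qed
  qed
  then show ?thesis
    using that r by blast
qed

end

context Metric_space
begin

section \<open>The Frechet-Urysohn property\<close>

lemma Frechet_Urysohn_words_upto_4:
  assumes T: "free_group_topology mtopology T" and k: "proper_at_0 k"
    and kd: "\<And>x y. x \<in> M \<Longrightarrow> y \<in> M \<Longrightarrow> x \<noteq> y \<Longrightarrow> k x \<le> d x y"
    and isolated: "\<And>x. x \<in> M \<Longrightarrow> k x = 0 \<or> openin mtopology {x}"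
  shows "Frechet_Urysohn_space (subtopology T (words_upto M 4))"
  unfolding Frechet_Urysohn_space_def
proof (intro allI impI, elim conjE)
  let ?Y = "subtopology T (words_upto M 4)"
  fix A w assume A: "A \<subseteq> topspace ?Y" and w: "w \<in> ?Y closure_of A"
  interpret W: weighted_metric M d "\<lambda>_. 1"
    by unfold_locales simp
  have tg: "topological_group (free_group M) T" and gen: "continuous_map mtopology T gen"
    using T by (auto simp: free_group_topology_def embedding_map_def continuous_map_in_subtopology
        dest: homeomorphic_imp_continuous_map)
  have A4: "A \<subseteq> words_upto M 4"
    using A by auto
  have w4: "w \<in> words_upto M 4" and wF: "w \<in> carrier (free_group M)" and wred: "reduced_word w"
    and wM: "fst ` set w \<subseteq> M"
    using w by (auto simp: in_closure_of words_upto_def carrier_free_group)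
  have meets: "\<exists>u\<in>A. u \<in> U" if "openin T U" "w \<in> U" for U
    using w that w4 openin_subtopology_Int[OF that(1), of "words_upto M 4"]
    unfolding in_closure_of by (metis IntD1 IntI)
  \<comment> \<open>A weight equal to 1 where \<open>k\<close> is small is locally constant: points
    close to a zero of \<open>k\<close> have small \<open>k\<close>, and all other points are
    isolated. It therefore defines a neighbourhood of \<open>w\<close>, which meets
    \<open>A\<close>.\<close>
  have weighted: "\<exists>u\<in>A. \<exists>c<\<epsilon>. matched M d s (inv_word w @ u) c"
    if s: "\<And>x. 1 \<le> s x" and \<eta>: "\<eta> > 0" "\<And>x. k x < \<eta> \<Longrightarrow> s x = 1" and \<epsilon>: "\<epsilon> > 0" for s \<eta> \<epsilon>
  proof -
    interpret s: weighted_metric M d s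
      by unfold_locales (rule s)
    have "\<exists>\<delta>>0. \<forall>y\<in>M. d x y < \<delta> \<longrightarrow> s y = s x" if x: "x \<in> M" for x
      using isolated[OF x]
    proof
      assume "k x = 0"
      have "s y = s x" if "y \<in> M" "d x y < \<eta>" for y
      proof (cases "y = x")
        case False
        then have "k y < \<eta>"
          using kd[of y x] x that by (simp add: commute)
        then show ?thesis
          using \<eta> \<open>k x = 0\<close> by simp
      qed simp
      then show ?thesis
        using \<eta>(1) by blast
    next
      assume "openin mtopology {x}"
      then obtain r where "r > 0" "mball x r \<subseteq> {x}"
        by (auto simp: openin_mtopology)
      then have "y = x" if "y \<in> M" "d x y < r" for y
        using that x by auto
      then show ?thesis
        using \<open>r > 0\<close> by blast
    qed
    note op = s.openin_free_group_topology_word_nbhd[OF T this wF, of \<epsilon>]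
    have "reduce (inv_word w @ w) = []"
      using reduce_append_inv_word[of "inv_word w" "[]"] by (simp add: reduce_def)
    then have "w \<in> {u \<in> carrier (free_group M). reduce (inv_word w @ u) \<in> s.word_nbhd \<epsilon>}"
      using wF \<epsilon> by (auto simp: s.word_nbhd_def carrier_free_group intro!: exI[of _ 0] matched.Nil)
    then obtain u c where "u \<in> A" "c < \<epsilon>" "u \<in> carrier (free_group M)"
      "matched M d s (reduce (inv_word w @ u)) c"
      using meets[OF op] by (auto simp: s.word_nbhd_def)
    then show ?thesis
      using s.matched_translate[OF _ wF] by (auto simp: carrier_free_group)
  qed
  \<comment> \<open>\<open>good Q n\<close> supplies the term with index \<open>n\<close> of a
    sequence as in \<open>matched_convergent_subseq\<close>; one finite \<open>Q\<close> has to
    serve for all \<open>n\<close>.\<close>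
  define good where "good Q n \<longleftrightarrow> (\<exists>u\<in>A. matched M d (\<lambda>_. 1) (inv_word w @ u) (inverse (Suc n)) \<and>
    (\<forall>x\<in>fst ` set u. near k Q n x))" for Q n
  have conclude: "\<exists>s. range s \<subseteq> A \<and> limitin ?Y s w sequentially"
    if Q: "finite Q" "Q \<subseteq> M" and good: "\<And>n. good Q n" for Q
  proof -
    obtain u where u: "\<And>n. u n \<in> A" "\<And>n. matched M d (\<lambda>_. 1) (inv_word w @ u n) (inverse (Suc n))"
      "\<And>n x. x \<in> fst ` set (u n) \<Longrightarrow> near k Q n x"
      using good unfolding good_def by metis
    have u4: "u n \<in> words_upto M 4" for n
      using u(1) A4 by blast
    obtain r where "strict_mono r" "limitin T (u \<circ> r) w sequentially"
      using matched_convergent_subseq[OF k tg gen wF Q u4 u(3,2)] by blast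
    then show ?thesis
      using u(1) u4 w4 by (intro exI[of _ "u \<circ> r"]) (auto simp: limitin_subtopology)
  qed
  show "\<exists>s. range s \<subseteq> A \<and> limitin ?Y s w sequentially"
  proof (cases "w = []")
    case False
    obtain \<eta> where \<eta>: "\<eta> > 0"
      "\<And>x y. x \<in> fst ` set w \<Longrightarrow> y \<in> fst ` set w \<Longrightarrow> x \<noteq> y \<Longrightarrow> \<eta> \<le> d x y"
      using finite_separated[of "fst ` set w"] wM by auto
    have "good (fst ` set w) n" for n
    proof -
      \<comment> \<open>The bound \<open>\<eta>\<close> meets the separation hypothesis of
        \<open>matched_near_word\<close>; the other bound gives the required nearness.\<close>
      obtain u c where u: "u \<in> A" "c < min \<eta> (inverse (Suc n))"
        "matched M d (\<lambda>_. 1) (inv_word w @ u) c"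
        using weighted[of "\<lambda>_. 1" 1 "min \<eta> (inverse (Suc n))"] \<eta>(1) by auto
      have u4: "reduced_word u" "length u \<le> 4" "fst ` set u \<subseteq> M"
        using u(1) A4 by (auto simp: words_upto_def carrier_free_group)
      have "near k (fst ` set w) n x" if x: "x \<in> fst ` set u" for x
      proof -
        have "k x \<le> c \<or> (\<exists>q\<in>fst ` set w. d q x \<le> c)"
          using u(2) \<eta>(2) by (intro W.matched_near_word[OF u(3) u4(1,2) kd wred False _ x]) force+
        then show ?thesis
          using u(2) u4(3) x unfolding near_def by fastforce
      qed
      moreover have "matched M d (\<lambda>_. 1) (inv_word w @ u) (inverse (Suc n))"
        using u by (intro W.matched_mono[OF u(3)]) simp
      ultimately show ?thesis
        using u(1) unfolding good_def by blast
    qed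
    then show ?thesis
      using wM by (intro conclude) auto
  next
    case True
    show ?thesis
    proof (rule ccontr)
      assume "\<not> ?thesis"
      then have not_good: "\<exists>n. \<not> good Q n" if "finite Q" "Q \<subseteq> M" for Q
        using conclude that by blast
      \<comment> \<open>Failure for the empty set fixes the scale at which a letter counts as close
        to the zeros of \<open>k\<close>.\<close>
      obtain n0 where n0: "\<not> good {} n0"
        using not_good[of "{}"] by auto
      \<comment> \<open>Failure for each singleton \<open>{x}\<close> supplies the number from which
        the weight at \<open>x\<close> is made.\<close>
      obtain N where N: "\<And>x. x \<in> M \<Longrightarrow> \<not> good {x} (N x)"
        using not_good[of "{_}"] by (metis empty_subsetI finite.emptyI finite.insertI insert_subset)
      define s where "s x = (if k x < inverse (Suc n0) then 1 else real (Suc (N x)))" for x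
      \<comment> \<open>\<open>s x\<close> is at least \<open>1 / \<rho> y z\<close> for \<open>x\<close> far from \<open>K\<close> and all \<open>x y z\<^sup>-\<^sup>1 x\<^sup>-\<^sup>1\<close> in \<open>A\<close>\<close>
      have s: "1 \<le> s x" "k x < inverse (Suc n0) \<Longrightarrow> s x = 1" for x
        by (auto simp: s_def)
      interpret s: weighted_metric M d s
        by unfold_locales (rule s)
      obtain u c where u: "u \<in> A" "c < inverse (Suc n0)" "matched M d s u c"
        using weighted[of s "inverse (Suc n0)" "inverse (Suc n0)", OF s(1) _ s(2)] True
        by (auto simp: inv_word_def)
      have u4: "reduced_word u" "length u \<le> 4" "fst ` set u \<subseteq> M"
        using u(1) A4 by (auto simp: words_upto_def carrier_free_group)
      have far: "\<not> (\<forall>x\<in>fst ` set u. k x < inverse (Suc n0))"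
      proof
        assume "\<forall>x\<in>fst ` set u. k x < inverse (Suc n0)"
        moreover have "matched M d (\<lambda>_. 1) u (inverse (Suc n0))"
          using W.matched_mono[OF s.matched_unweighted[OF u(3)]] u(2) by simp
        ultimately have "good {} n0"
          using u(1) u4(3) True by (auto simp: good_def near_def inv_word_def)
        with n0 show False ..
      qed
      then have "\<not> (\<forall>x\<in>fst ` set u. k x \<le> c)"
        using u(2) by (meson le_less_trans)
      then obtain x e y f z where xyz: "u = [(x, e), (y, f), (z, \<not> f), (x, \<not> e)]"
        "x \<in> M" "y \<in> M" "z \<in> M" "y \<noteq> z" "s x * d y z \<le> c"
        using s.matched_short[OF u(3) u4(1,2) kd] by blast
      have yz: "k y \<le> d y z" "k z \<le> d y z"
        using kd[of y z] kd[of z y] xyz by (auto simp: commute)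
      \<comment> \<open>This puts \<open>y\<close> and \<open>z\<close> below the threshold set by
        \<open>n0\<close>, so the letter that is far must be \<open>x\<close>, and its weight is
        \<open>Suc (N x)\<close>.\<close>
      have "d y z \<le> c"
        using s.le_weight_mult[of "d y z" x] xyz(6) by simp
      with far yz u(2) xyz(1) have "\<not> k x < inverse (Suc n0)"
        by auto
      then have "real (Suc (N x)) * d y z \<le> c"
        using xyz(6) by (simp add: s_def)
      also have "c < 1"
        using u(2) inverse_le_1_iff[of "real (Suc n0)"] by linarith
      finally have yz': "d y z < inverse (real (Suc (N x)))"
        by (simp add: field_simps)
      \<comment> \<open>Without weights \<open>u\<close> costs only \<open>d y z\<close>, since its
        outer letters coincide. Its letters are \<open>x\<close> or have small \<open>k\<close>,
        contrary to the choice of \<open>N x\<close>.\<close>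
      have "matched M d (\<lambda>_. 1) ((y, f) # [] @ [(z, \<not> f)]) (d y z)"
        using xyz by (intro W.matched_wrap[where a = 0] matched.Nil) auto
      then have "matched M d (\<lambda>_. 1) ((x, e) # [(y, f), (z, \<not> f)] @ [(x, \<not> e)]) (inverse (Suc (N x)))"
        using xyz yz' by (intro W.matched_wrap[where a = "d y z"]) auto
      then have "good {x} (N x)"
        using u(1) xyz yz yz' True by (auto simp: good_def near_def inv_word_def intro!: bexI[of _ u])
      with N xyz(2) show False
        by blast
    qed
  qed
qed

end

text \<open>Adding \<open>max (k x) (k y)\<close> to the distance of distinct points, where \<open>k\<close> is the distance to
  \<open>K\<close>, keeps the topology because points outside \<open>K\<close> are isolated.\<close>

lemma metric_isolating_compact_derived_set:
  fixes X :: "'a topology"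
  defines "K \<equiv> {x \<in> topspace X. \<not> openin X {x}}"
  assumes "metrizable_space X" "compactin X K"
  obtains \<rho> k where "Metric_space (topspace X) \<rho>" "Metric_space.mtopology (topspace X) \<rho> = X"
    "Metric_space.proper_at_0 (topspace X) \<rho> k"
    "\<And>x y. x \<in> topspace X \<Longrightarrow> y \<in> topspace X \<Longrightarrow> x \<noteq> y \<Longrightarrow> k x \<le> \<rho> x y"
    "\<And>x. x \<in> topspace X \<Longrightarrow> k x = 0 \<or> openin X {x}"
proof -
  obtain M d where "Metric_space M d" and X: "X = Metric_space.mtopology M d"
    using assms(2) by (auto simp: metrizable_space_def)
  then interpret Metric_space M d by simp
  have M: "topspace X = M"
    by (simp add: X)
  \<comment> \<open>With the value 1 for empty \<open>K\<close>, no sequence satisfies the premise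
    of \<open>proper_at_0\<close>.\<close>
  define k where "k x = (if K = {} then 1 else Inf (d x ` K))" for x
  define \<rho> where "\<rho> x y = (if x = y then 0 else d x y + max (k x) (k y))" for x y
  have K: "K \<subseteq> M"
    by (auto simp: K_def M)
  have k0: "0 \<le> k x" for x
    by (auto simp: k_def intro!: cInf_greatest)
  have kd: "k x \<le> d x y" if "y \<in> K" for x y
    using that by (auto simp: k_def intro!: cInf_lower bdd_belowI[of _ 0])
  have kK: "k x = 0" if "x \<in> K" for x
    using kd[OF that, of x] k0[of x] that K by auto
  have le: "d x y \<le> \<rho> x y" "k x \<le> \<rho> x y" if "x \<in> M" "y \<in> M" "x \<noteq> y" for x y
    using that k0[of x] by (auto simp: \<rho>_def intro!: add_increasing)
  interpret \<rho>: Metric_space M \<rho>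
  proof
    show "0 \<le> \<rho> x y" for x y
      using k0[of x] by (auto simp: \<rho>_def intro!: add_nonneg_nonneg)
    show "\<rho> x y = \<rho> y x" for x y
      by (auto simp: \<rho>_def commute max.commute)
    show "\<rho> x y = 0 \<longleftrightarrow> x = y" if "x \<in> M" "y \<in> M" for x y
    proof (cases "x = y")
      case False
      then have "0 < d x y + max (k x) (k y)"
        using that k0[of x] by (intro add_pos_nonneg) (auto simp: le_max_iff_disj)
      with False show ?thesis
        by (simp add: \<rho>_def)
    qed (simp add: \<rho>_def)
    show "\<rho> x z \<le> \<rho> x y + \<rho> y z" if "x \<in> M" "y \<in> M" "z \<in> M" for x y z
      using that triangle[of x y z] k0[of x] k0[of y] k0[of z] nonneg[of x y] nonneg[of y z]
      by (auto simp: \<rho>_def max_def)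
  qed
  have iso: "k x = 0 \<or> openin X {x}" if "x \<in> topspace X" for x
    using that kK by (auto simp: K_def)
  have top: "\<rho>.mtopology = X"
    unfolding X topology_eq
  proof (intro allI iffI)
    fix U assume U: "openin \<rho>.mtopology U"
    show "openin mtopology U"
      unfolding openin_mtopology
    proof (intro conjI allI impI)
      show "U \<subseteq> M"
        using U by (simp add: \<rho>.openin_mtopology)
      fix x assume x: "x \<in> U"
      then obtain r where r: "r > 0" "\<rho>.mball x r \<subseteq> U"
        using U by (auto simp: \<rho>.openin_mtopology)
      have xM: "x \<in> M"
        using x \<open>U \<subseteq> M\<close> by blast
      show "\<exists>r>0. mball x r \<subseteq> U"
      proof (cases "x \<in> K")
        case True
        \<comment> \<open>For \<open>x\<close> in \<open>K\<close> both \<open>k x = 0\<close> and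
          \<open>k y \<le> d x y\<close> hold, so \<open>\<rho> x y\<close> is at most twice
          \<open>d x y\<close>.\<close>
        have "y \<in> U" if "y \<in> M" "d x y < r / 2" for y
        proof -
          have "\<rho> x y < r"
            using kd[OF True, of y] kK[OF True] k0[of y] that r(1) by (auto simp: \<rho>_def commute)
          then show ?thesis
            using r(2) xM that by auto
        qed
        then show ?thesis
          using r(1) by (intro exI[of _ "r / 2"]) auto
      next
        case False
        then have "openin mtopology {x}"
          using xM by (simp add: K_def X)
        then obtain r where "r > 0" "mball x r \<subseteq> {x}"
          by (auto simp: openin_mtopology)
        then show ?thesis
          using x by blast
      qed
    qed
  next
    fix U assume U: "openin mtopology U"
    show "openin \<rho>.mtopology U"
      unfolding \<rho>.openin_mtopology
    proof (intro conjI allI impI)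
      show "U \<subseteq> M"
        using U by (simp add: openin_mtopology)
      fix x assume "x \<in> U"
      then obtain r where r: "r > 0" "mball x r \<subseteq> U"
        using U by (auto simp: openin_mtopology)
      moreover have "\<rho>.mball x r \<subseteq> mball x r"
        using le(1)[of x] r(1) by force
      ultimately show "\<exists>r>0. \<rho>.mball x r \<subseteq> U"
        by blast
    qed
  qed
  have "\<rho>.proper_at_0 k"
    unfolding \<rho>.proper_at_0_def top
  proof (intro conjI allI impI)
    fix \<sigma> :: "nat \<Rightarrow> 'a" assume \<sigma>: "range \<sigma> \<subseteq> M" "(\<lambda>n. k (\<sigma> n)) \<longlonglongrightarrow> 0"
    have "K \<noteq> {}"
      using \<sigma>(2) by (auto simp: k_def tendsto_const_iff)
    \<comment> \<open>The infimum is only approximated. Compactness is applied to these almost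
      nearest points \<open>a n\<close>, and \<open>\<sigma>\<close> has the same limit along the
      subsequence.\<close>
    have "\<exists>a\<in>K. d (\<sigma> n) a < k (\<sigma> n) + inverse (Suc n)" for n
      using cInf_lessD[of "d (\<sigma> n) ` K" "k (\<sigma> n) + inverse (Suc n)"] \<open>K \<noteq> {}\<close> by (auto simp: k_def)
    then obtain a where a: "\<And>n. a n \<in> K" "\<And>n. d (\<sigma> n) (a n) < k (\<sigma> n) + inverse (Suc n)"
      by metis
    obtain l r where l: "l \<in> K" "strict_mono r" "limitin mtopology (a \<circ> r) l sequentially"
      using assms(3) a(1) unfolding X compactin_sequentially by (metis image_subsetI)
    have "(\<lambda>n. k (\<sigma> n) + inverse (Suc n)) \<longlonglongrightarrow> 0 + 0"
      by (intro tendsto_add \<sigma>(2) LIMSEQ_inverse_real_of_nat)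
    from LIMSEQ_subseq_LIMSEQ[OF this l(2)]
    have lim: "(\<lambda>n. k (\<sigma> (r n)) + inverse (Suc (r n)) + d (a (r n)) l) \<longlonglongrightarrow> 0 + 0"
      using l(3) by (intro tendsto_add) (auto simp: limitin_metric_dist_null o_def)
    have "d (\<sigma> (r n)) l \<le> k (\<sigma> (r n)) + inverse (Suc (r n)) + d (a (r n)) l" for n
      using triangle[of "\<sigma> (r n)" "a (r n)" l] a(2)[of "r n"] a(1)[of "r n"] \<sigma>(1) l(1) K
      by (fastforce simp: subset_iff)
    then have "(\<lambda>n. d (\<sigma> (r n)) l) \<longlonglongrightarrow> 0"
      by (auto intro!: tendsto_sandwich[OF always_eventually always_eventually tendsto_const lim[simplified]])
    then have "limitin mtopology (\<sigma> \<circ> r) l sequentially"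
      using l(1) K \<sigma>(1) by (auto simp: limitin_metric_dist_null o_def subset_iff)
    then show "\<exists>a\<in>M. \<exists>r. strict_mono r \<and> limitin X (\<sigma> \<circ> r) a sequentially"
      using l K X by blast
  qed (rule k0)
  then show ?thesis
    using that[of \<rho> k] \<rho>.Metric_space_axioms top le(2) iso by (simp add: M)
qed

theorem theorem3p3:
  fixes X :: "'a topology" and T :: "'a word topology"
  assumes "metrizable_space X"
    and "compactin X {x \<in> topspace X. \<not> openin X {x}}"
    and "free_group_topology X T"
  shows "Frechet_Urysohn_space (subtopology T (words_upto (topspace X) 4))"
proof -
  obtain \<rho> k where "Metric_space (topspace X) \<rho>" and X: "Metric_space.mtopology (topspace X) \<rho> = X"
    and k: "Metric_space.proper_at_0 (topspace X) \<rho> k"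
    "\<And>x y. x \<in> topspace X \<Longrightarrow> y \<in> topspace X \<Longrightarrow> x \<noteq> y \<Longrightarrow> k x \<le> \<rho> x y"
    "\<And>x. x \<in> topspace X \<Longrightarrow> k x = 0 \<or> openin X {x}"
    using metric_isolating_compact_derived_set[OF assms(1,2)] by blast
  interpret Metric_space "topspace X" \<rho> by fact
  show ?thesis
    using Frechet_Urysohn_words_upto_4[of T k] k assms(3) unfolding X by blast
qed

end
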